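(* There is an absolute constant $c>0$ such that the following holds. Let $s\ge3$ be any integer and let $\mu<1$. There is a constant $C_{\mu,s}>0$ depending only on $\mu$ and $s$ such that for every $f\in C^{s-1}([0,1])$ with $f^{(s-1)}\in\mathrm{Lip}([0,1])$ and $\|f\|_\infty\le\mu<1$, and for every positive integer $n\ge c\,\|f^{(2)}\|_\infty/(1-\mu)$, there exist signs $\sigma_0,\dots,\sigma_n\in\{\pm1\}$ such that for all $x\in[0,1]$, with $X:=x(1-x)$, $$\left|f(x)-\sum_{k=0}^n\sigma_k\,p_{n,k}(x)\right|\le C_{\mu,s}\left(\|f\|_{C^{s-1}\mathrm{Lip}}\,n^{-s/2}+\min\big(1,X^{-s}n^{-s/2}\big)\right).$$
   Context: Functions are real-valued; $\|\cdot\|_\infty$ is the supremum norm on $[0,1]$. For $0\le k\le n$, $p_{n,k}(x):=\binom{n}{k}x^k(1-x)^{n-k}$. $\mathrm{Lip}([0,1])$ is the space of Lipschitz functions on $[0,1]$ and $|g|_{\mathrm{Lip}}$ is the smallest Lipschitz constant of $g$. $\|f\|_{C^{s-1}\mathrm{Lip}}:=\max\big(\|f\|_{C^{s-1}},|f^{(s-1)}|_{\mathrm{Lip}}\big)$, where $\|f\|_{C^{s-1}}$ is the usual norm $\max_{0\le j\le s-1}\|f^{(j)}\|_\infty$. When $X=0$, $\min(1,X^{-s}n^{-s/2})$ is interpreted as $1$. *)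

theory Defs
  imports "HOL-Analysis.Analysis"
begin

text \<open>
  A function on the unit interval is represented by a total function of type real to real
  of which only the values on \<^term>\<open>{0..1::real}\<close> are used.  Derivatives are taken within the
  interval, hence are one-sided at the endpoints.
\<close>

definition deriv01 :: "nat \<Rightarrow> (real \<Rightarrow> real) \<Rightarrow> real \<Rightarrow> real" where
  "deriv01 j f = ((\<lambda>g x. vector_derivative g (at x within {0..1})) ^^ j) f"

definition C01 :: "nat \<Rightarrow> (real \<Rightarrow> real) set" where
  "C01 m = {f. (\<forall>j<m. deriv01 j f differentiable_on {0..1}) \<and>
               continuous_on {0..1} (deriv01 m f)}"

definition sup_norm01 :: "(real \<Rightarrow> real) \<Rightarrow> real" where
  "sup_norm01 g = (SUP x\<in>{0..1}. \<bar>g x\<bar>)"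

definition Lip01 :: "(real \<Rightarrow> real) set" where
  "Lip01 = {g. \<exists>L. L-lipschitz_on {0..1} g}"

text \<open>For \<^term>\<open>g \<in> Lip01\<close> the infimum below is attained.\<close>

definition lip_seminorm01 :: "(real \<Rightarrow> real) \<Rightarrow> real" where
  "lip_seminorm01 g = Inf {L. L-lipschitz_on {0..1} g}"

definition C_norm01 :: "nat \<Rightarrow> (real \<Rightarrow> real) \<Rightarrow> real" where
  "C_norm01 m f = Max ((\<lambda>j. sup_norm01 (deriv01 j f)) ` {0..m})"

definition CLip_norm01 :: "nat \<Rightarrow> (real \<Rightarrow> real) \<Rightarrow> real" where
  "CLip_norm01 m f = max (C_norm01 m f) (lip_seminorm01 (deriv01 m f))"

text \<open>
  The term \<open>min (1, X\<^sup>-\<^sup>s n\<^sup>-\<^sup>s\<^sup>/\<^sup>2)\<close>.  The case \<open>X = 0\<close> is separate because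
  \<^term>\<open>0 powr a = (0::real)\<close> in HOL.
\<close>

definition endpoint_term :: "nat \<Rightarrow> nat \<Rightarrow> real \<Rightarrow> real" where
  "endpoint_term s n X =
     (if X = 0 then 1 else min 1 (X powr (- real s) * real n powr (- real s / 2)))"

end

theory Submission
  imports Defs "HOL-Computational_Algebra.Polynomial_FPS"
begin

text \<open>
  Take as \<open>a k\<close> the \<open>k\<close>-th Bernstein coefficient of the Taylor polynomial of \<open>f\<close> of degree
  \<open>s - 1\<close> at \<open>k / n\<close>.  Bernstein coefficients of \<open>(y - k/n) ^ j\<close> are \<open>O(n\<^sup>-\<^sup>j\<^sup>/\<^sup>2)\<close>, so Taylor's theorem
  and the moments of the binomial distribution give an error of order \<open>n\<^sup>-\<^sup>s\<^sup>/\<^sup>2\<close>.  Sigma-delta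
  quantization of order \<open>s\<close> then finds signs with \<open>a - \<sigma> = \<Delta>\<^sup>s u\<close> for a bounded \<open>u\<close>, and summation by
  parts leaves the \<open>\<ell>\<^sup>1\<close> norm of the \<open>s\<close>-th difference of \<open>p\<^sub>n\<^sub>,\<^sub>k(x)\<close> in \<open>k\<close>, which is
  \<open>O(min (1, (n X)\<^sup>-\<^sup>s\<^sup>/\<^sup>2))\<close>.

  Stability of the quantizer requires the \<open>\<bar>a k\<bar>\<close> to stay away from \<open>1\<close>.  If \<open>n\<close> is large
  and the Lipschitz constant of the last derivative is at most a small multiple of \<open>n\<^sup>s\<^sup>/\<^sup>2\<close>, then an
  interpolation inequality makes all \<open>n\<^sup>-\<^sup>j\<^sup>/\<^sup>2 \<bar>f\<^sup>(\<^sup>j\<^sup>)\<bar>\<close>, \<open>j \<ge> 1\<close>, small, and \<open>a k\<close> is close to \<open>f (k / n)\<close>.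
  Otherwise the right-hand side exceeds \<open>2\<close> for a suitable constant, and any signs will do.
\<close>

subsection \<open>The \<open>\<ell>\<^sup>1\<close> norm of a polynomial\<close>

text \<open>Submultiplicative, because polynomials multiply by convolving their coefficients.
  Summing over the list \<open>coeffs p\<close> makes the norm recursive along \<open>pCons\<close>,
  so that most estimates go by induction on the polynomial.\<close>

definition l1_norm :: "real poly \<Rightarrow> real" where
  "l1_norm p = (\<Sum>a\<leftarrow>coeffs p. \<bar>a\<bar>)"

lemma l1_norm_0 [simp]: "l1_norm 0 = 0"
  by (simp add: l1_norm_def)

lemma l1_norm_pCons [simp]: "l1_norm (pCons a p) = \<bar>a\<bar> + l1_norm p"
  by (simp add: l1_norm_def cCons_def)

lemma l1_norm_1 [simp]: "l1_norm 1 = 1"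
  by (simp add: one_pCons)

lemma l1_norm_nonneg [simp]: "l1_norm p \<ge> 0"
  by (induction p) auto

lemma l1_norm_smult [simp]: "l1_norm (smult c p) = \<bar>c\<bar> * l1_norm p"
  by (induction p) (auto simp: abs_mult algebra_simps)

lemma l1_norm_minus [simp]: "l1_norm (- p) = l1_norm p"
  using l1_norm_smult[of "-1" p] by simp

lemma l1_norm_add_le: "l1_norm (p + q) \<le> l1_norm p + l1_norm q"
proof (induction p q rule: poly_induct2)
  case (pCons a p b q)
  then show ?case
    using abs_triangle_ineq[of a b] by simp
qed simp

lemma l1_norm_diff_le: "l1_norm (p - q) \<le> l1_norm p + l1_norm q"
  using l1_norm_add_le[of p "- q"] by simp

lemma l1_norm_mult_le: "l1_norm (p * q) \<le> l1_norm p * l1_norm q"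
proof (induction p)
  case (pCons a p)
  have "l1_norm (pCons a p * q) \<le> l1_norm (smult a q) + l1_norm (pCons 0 (p * q))"
    unfolding mult_pCons_left by (rule l1_norm_add_le)
  with pCons show ?case
    by (simp add: algebra_simps)
qed simp

lemma l1_norm_power_le: "l1_norm (p ^ n) \<le> l1_norm p ^ n"
proof (induction n)
  case (Suc n)
  have "l1_norm (p ^ Suc n) \<le> l1_norm p * l1_norm (p ^ n)"
    by (simp add: l1_norm_mult_le)
  also have "\<dots> \<le> l1_norm p * l1_norm p ^ n"
    by (intro mult_left_mono Suc) simp
  finally show ?case by simp
qed simp

lemma sum_abs_coeff_le_l1_norm: "(\<Sum>i\<le>N. \<bar>coeff p i\<bar>) \<le> l1_norm p"
proof (induction p arbitrary: N)
  case (pCons a p)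
  show ?case
  proof (cases N)
    case (Suc M)
    then show ?thesis
      using pCons.IH[of M] by (simp add: sum.atMost_Suc_shift del: sum.atMost_Suc)
  qed simp
qed simp

lemma abs_coeff_le_l1_norm: "\<bar>coeff p i\<bar> \<le> l1_norm p"
proof -
  have "\<bar>coeff p i\<bar> \<le> (\<Sum>i\<le>i. \<bar>coeff p i\<bar>)"
    by (rule member_le_sum) auto
  also note sum_abs_coeff_le_l1_norm
  finally show ?thesis .
qed

lemma l1_norm_eq_sum:
  assumes "degree p \<le> N"
  shows "l1_norm p = (\<Sum>i\<le>N. \<bar>coeff p i\<bar>)"
  using assms
proof (induction p arbitrary: N)
  case (pCons a p)
  show ?case
  proof (cases N)
    case 0
    with pCons show ?thesis by (simp split: if_splits)
  next
    case (Suc M)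
    with pCons.prems have "degree p \<le> M"
      by (cases "p = 0") auto
    from pCons.IH[OF this] Suc show ?thesis
      by (simp add: sum.atMost_Suc_shift del: sum.atMost_Suc)
  qed
qed simp

text \<open>Horner's scheme: each step multiplies by \<open>q\<close>, which does not increase the
  norm, and adds one coefficient of \<open>p\<close>.\<close>

lemma l1_norm_pcompose_le:
  assumes "l1_norm q \<le> 1"
  shows "l1_norm (pcompose p q) \<le> l1_norm p"
proof (induction p)
  case (pCons a p)
  have "l1_norm (pcompose (pCons a p) q) \<le> l1_norm [:a:] + l1_norm (q * pcompose p q)"
    unfolding pcompose_pCons by (rule l1_norm_add_le)
  also have "\<dots> \<le> \<bar>a\<bar> + 1 * l1_norm (pcompose p q)"
    by (intro add_mono order.trans[OF l1_norm_mult_le] mult_right_mono assms) simp_all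
  finally show ?case using pCons by simp
qed simp

text \<open>Young's inequality for the convolution of a summable with a bounded sequence; here
  \<open>V\<close> is the bounded quantizer state.\<close>

lemma fps_mult_nth_le_l1_norm:
  assumes "\<And>i. \<bar>fps_nth V i\<bar> \<le> K"
  shows "\<bar>fps_nth (fps_of_poly p * V) n\<bar> \<le> l1_norm p * K"
proof -
  have "\<bar>fps_nth (fps_of_poly p * V) n\<bar> \<le> (\<Sum>i\<le>n. \<bar>coeff p i * fps_nth V (n - i)\<bar>)"
    by (simp add: fps_mult_nth atMost_atLeast0 sum_abs)
  also have "\<dots> \<le> (\<Sum>i\<le>n. \<bar>coeff p i\<bar> * K)"
    by (intro sum_mono) (simp add: abs_mult assms mult_left_mono)
  also have "\<dots> = (\<Sum>i\<le>n. \<bar>coeff p i\<bar>) * K"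
    by (simp add: sum_distrib_right)
  also have "\<dots> \<le> l1_norm p * K"
    using assms[of 0] by (intro mult_right_mono sum_abs_coeff_le_l1_norm) simp
  finally show ?thesis .
qed

subsection \<open>Sigma-delta quantization of arbitrary order\<close>

text \<open>
  The induction combines the filter for order \<open>s\<close> with its dilation by a large factor so that
  one more vanishing moment appears (Richardson extrapolation); the weight \<open>1 / M ^ s\<close> of the
  dilation is small, so the norm hardly grows.
\<close>

lemma ex_sigma_delta_filter:
  assumes "s \<ge> 1" "B > 1"
  shows "\<exists>H g. poly H 0 = 0 \<and> 1 - H = [:1, -1:] ^ s * g \<and> l1_norm H \<le> B"
  using assms
proof (induction s arbitrary: B rule: nat_induct_at_least)
  case base
  then show ?case
    by (intro exI[of _ "[:0, 1:]"] exI[of _ 1]) (simp add: one_pCons)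
next
  case (Suc s)
  define B0 where "B0 = (1 + B) / 2"
  have B0: "B0 > 1" "B0 < B" using Suc.prems by (auto simp: B0_def)
  obtain H g where H: "poly H 0 = 0" "1 - H = [:1, -1:] ^ s * g" "l1_norm H \<le> B0"
    using Suc.IH[OF B0(1)] by blast
  \<comment> \<open>With this threshold, \<open>e \<le> \<delta>\<close> is equivalent to
    \<open>(1 + e) * B0 \<le> (1 - e) * B\<close>, from which the bound on \<open>l1_norm H'\<close>
    follows.\<close>
  define \<delta> where "\<delta> = (B - B0) / (B + B0)"
  have \<delta>: "\<delta> > 0" "\<delta> < 1" using B0 by (auto simp: \<delta>_def field_simps)
  obtain M :: nat where M: "1 / \<delta> < real M"
    using reals_Archimedean2 by blast
  have "1 / \<delta> > 1" using \<delta> by simp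
  with M have M1: "M > 1" by linarith
  \<comment> \<open>The weight with \<open>e * real M ^ s = 1\<close>: it compensates the value at 1
    of the cofactor \<open>c ^ s\<close> that the dilation produces.\<close>
  define e where "e = 1 / real M ^ s"
  have "e \<le> 1 / real M"
    unfolding e_def using M1 Suc.hyps
    by (intro divide_left_mono) (auto intro: self_le_power)
  also have "\<dots> < \<delta>"
    using M \<delta> M1 by (simp add: field_simps)
  finally have e: "e > 0" "e < \<delta>" using M1 by (auto simp: e_def)
  define Z :: "real poly" where "Z = monom 1 M"
  \<comment> \<open>Dividing by \<open>1 - e\<close> makes \<open>1 - H'\<close> a normalized
    combination of \<open>1 - H\<close> and \<open>1 - pcompose H Z\<close>, both divisible by
    \<open>[:1, -1:] ^ s\<close>.\<close>
  define H' where "H' = smult (1 / (1 - e)) (H - smult e (pcompose H Z))"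
  have Z0: "poly Z 0 = 0" and Z1: "poly Z 1 = 1" using M1 by (auto simp: Z_def poly_monom)
  have norm_Z: "l1_norm Z = 1"
    unfolding Z_def by (induction M) (auto simp: monom_0 monom_Suc)
  define c :: "real poly" where "c = (\<Sum>i<M. monom 1 i)"
  have Zc: "1 - Z = [:1, -1:] * c"
  proof (rule poly_eq_poly_eq_iff[THEN iffD1], rule ext)
    fix x show "poly (1 - Z) x = poly ([:1, -1:] * c) x"
      using one_diff_power_eq[of x M]
      by (simp add: Z_def c_def poly_sum poly_monom algebra_simps)
  qed
  have c1: "poly c 1 = real M" by (simp add: c_def poly_sum poly_monom)
  have eM: "e * real M ^ s = 1" using M1 by (simp add: e_def)
  define r where "r = g - smult e (c ^ s * pcompose g Z)"
  \<comment> \<open>The additional vanishing moment: both terms of \<open>r\<close> take the value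
    \<open>poly g 1\<close> at 1.\<close>
  have "poly r 1 = 0"
    using eM by (simp add: r_def poly_power c1 poly_pcompose Z1 mult.assoc[symmetric])
  then obtain r' where r': "r = [:-1, 1:] * r'"
    by (auto simp: poly_eq_0_iff_dvd dvd_def)
  have "1 - pcompose H Z = pcompose (1 - H) Z"
    by (simp add: pcompose_diff pcompose_1)
  also have "\<dots> = (1 - Z) ^ s * pcompose g Z"
  proof -
    have "pcompose ([:1, -1:] ^ s) Z = (pcompose [:1, -1:] Z) ^ s"
      by (induction s) (simp_all only: power_0 power_Suc pcompose_1 pcompose_mult)
    moreover have "pcompose [:1, -1:] Z = 1 - Z"
      by (simp add: pcompose_pCons one_pCons)
    ultimately show ?thesis
      by (simp only: H(2) pcompose_mult)
  qed
  also have "\<dots> = [:1, -1:] ^ s * (c ^ s * pcompose g Z)"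
    by (simp only: Zc power_mult_distrib mult.assoc)
  finally have HZ: "1 - pcompose H Z = [:1, -1:] ^ s * (c ^ s * pcompose g Z)" .
  have ne: "1 - e \<noteq> 0" using e \<delta> by simp
  have "smult (1 - e) (1 - H') = (1 - H) - smult e (1 - pcompose H Z)"
    using ne by (simp add: H'_def smult_diff_right smult_diff_left one_pCons)
  also have "\<dots> = [:1, -1:] ^ s * r"
    by (simp add: H(2) HZ r_def algebra_simps)
  also have "\<dots> = [:1, -1:] ^ Suc s * (- r')"
    by (simp add: r' algebra_simps)
  finally have *: "smult (1 - e) (1 - H') = [:1, -1:] ^ Suc s * (- r')" .
  have "1 - H' = smult (1 / (1 - e)) (smult (1 - e) (1 - H'))"
    using ne by simp
  also have "\<dots> = [:1, -1:] ^ Suc s * smult (1 / (1 - e)) (- r')"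
    unfolding * by (rule mult_smult_right[symmetric])
  finally have div: "1 - H' = [:1, -1:] ^ Suc s * smult (1 / (1 - e)) (- r')" .
  have "l1_norm (H - smult e (pcompose H Z)) \<le> l1_norm H + e * l1_norm (pcompose H Z)"
    using l1_norm_diff_le[of H "smult e (pcompose H Z)"] e by simp
  also have "\<dots> \<le> B0 + e * B0"
    using H(3) l1_norm_pcompose_le[of Z H] norm_Z e by (intro add_mono mult_left_mono) auto
  also have "\<dots> \<le> (1 - e) * B"
  proof -
    have "e * (B + B0) \<le> B - B0"
      using e(2) B0 by (simp add: \<delta>_def field_simps)
    then show ?thesis by (simp add: algebra_simps)
  qed
  finally have "l1_norm H' \<le> B"
    using e \<delta> by (simp add: H'_def field_simps)
  moreover have "poly H' 0 = 0"
    using H(1) by (simp add: H'_def poly_pcompose Z0)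
  ultimately show ?case using div by blast
qed

text \<open>The greedy rule: the sign of \<open>w\<close> is emitted and the remaining error becomes
  the state. Only strictly earlier states enter, which corresponds to a filter with
  \<open>h 0 = 0\<close>.\<close>

fun sigma_delta_state :: "(nat \<Rightarrow> real) \<Rightarrow> (nat \<Rightarrow> real) \<Rightarrow> nat \<Rightarrow> real" where
  "sigma_delta_state h a k =
     (let w = a k + (\<Sum>i<k. h (k - i) * sigma_delta_state h a i)
      in w - (if w \<ge> 0 then 1 else -1))"

declare sigma_delta_state.simps [simp del]

text \<open>If the earlier states are bounded by 1, then
  \<open>\<bar>w k\<bar> \<le> \<nu> + (2 - \<nu>) = 2\<close>, and subtracting the sign of
  \<open>w k\<close> leads back to a state bounded by 1.\<close>

lemma sigma_delta_stable:
  assumes H: "poly H 0 = 0" "l1_norm H \<le> 2 - \<nu>"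
    and a: "\<And>k. \<bar>a k\<bar> \<le> \<nu>"
  obtains \<sigma> V where
    "\<And>k. \<sigma> k \<in> {-1, 1}" "\<And>k. \<bar>fps_nth V k\<bar> \<le> 1"
    "Abs_fps (\<lambda>k. a k - \<sigma> k) = fps_of_poly (1 - H) * V"
proof -
  define v where "v = sigma_delta_state (coeff H) a"
  define w where "w = (\<lambda>k. a k + (\<Sum>i<k. coeff H (k - i) * v i))"
  define \<sigma> where "\<sigma> = (\<lambda>k. if w k \<ge> 0 then 1 else -1 :: real)"
  have v: "v k = w k - \<sigma> k" for k
    unfolding w_def \<sigma>_def v_def by (subst sigma_delta_state.simps) (simp add: Let_def)
  have H0: "coeff H 0 = 0" using H(1) by (simp add: poly_0_coeff_0)
  \<comment> \<open>Since the filter vanishes at 0, the term \<open>i = k\<close> can be added, and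
    the sum becomes a Cauchy product.\<close>
  have conv: "(\<Sum>i<k. coeff H (k - i) * v i) = (\<Sum>i\<le>k. coeff H (k - i) * v i)" for k
    by (simp add: lessThan_Suc_atMost[symmetric] H0)
  have bound: "\<bar>v k\<bar> \<le> 1" for k
  proof (induction k rule: less_induct)
    case (less k)
    have "\<bar>\<Sum>i<k. coeff H (k - i) * v i\<bar> \<le> (\<Sum>i<k. \<bar>coeff H (k - i)\<bar>)"
    proof (rule order.trans[OF sum_abs], rule sum_mono)
      fix i assume "i \<in> {..<k}"
      then have "\<bar>v i\<bar> \<le> 1" using less by simp
      then show "\<bar>coeff H (k - i) * v i\<bar> \<le> \<bar>coeff H (k - i)\<bar>"
        by (simp add: abs_mult mult_left_le)
    qed
    also have "\<dots> \<le> (\<Sum>i\<le>k. \<bar>coeff H (k - i)\<bar>)"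
      by (intro sum_mono2) auto
    also have "\<dots> = (\<Sum>i\<le>k. \<bar>coeff H i\<bar>)"
      by (rule sum.nat_diff_reindex[of _ "Suc k", unfolded lessThan_Suc_atMost, simplified])
    also have "\<dots> \<le> l1_norm H" by (rule sum_abs_coeff_le_l1_norm)
    finally have "\<bar>w k\<bar> \<le> 2"
      unfolding w_def using a[of k] H(2) by linarith
    then show ?case
      unfolding v \<sigma>_def by (auto simp: abs_le_iff)
  qed
  show ?thesis
  proof
    show "\<sigma> k \<in> {-1, 1}" for k by (auto simp: \<sigma>_def)
    show "\<bar>fps_nth (Abs_fps v) k\<bar> \<le> 1" for k by (simp add: bound)
    show "Abs_fps (\<lambda>k. a k - \<sigma> k) = fps_of_poly (1 - H) * Abs_fps v"
    proof (rule fps_ext)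
      fix k
      have "fps_nth (fps_of_poly H * Abs_fps v) k = (\<Sum>i\<le>k. coeff H (k - i) * v i)"
        by (subst mult.commute) (simp add: fps_mult_nth atMost_atLeast0 mult.commute)
      moreover have "a k - \<sigma> k = v k - (\<Sum>i\<le>k. coeff H (k - i) * v i)"
        using v[of k] conv[of k] by (simp add: w_def)
      ultimately show "fps_nth (Abs_fps (\<lambda>k. a k - \<sigma> k)) k = fps_nth (fps_of_poly (1 - H) * Abs_fps v) k"
        by (simp add: fps_of_poly_diff left_diff_distrib)
    qed
  qed
qed

subsection \<open>Finite differences of the Bernstein basis\<close>

text \<open>The generating function of the Bernstein weights in \<open>k\<close>. Multiplying it by
  \<open>[:1, -1:]\<close> takes a difference in \<open>k\<close>.\<close>

lemma coeff_Bernstein_poly: "coeff ([:1 - x, x:] ^ n) k = Bernstein n k x"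
proof (cases "k \<le> n")
  case True
  then show ?thesis
    by (simp add: Bernstein_def coeff_linear_poly_power)
next
  case False
  have "degree ([:1 - x, x:] ^ n) \<le> n"
    by (rule order.trans[OF degree_power_le]) simp
  with False show ?thesis
    by (simp add: coeff_eq_0 Bernstein_def)
qed

lemma Bernstein_reflect: "k \<le> n \<Longrightarrow> Bernstein n (n - k) (1 - x) = Bernstein n k x"
  by (simp add: Bernstein_def binomial_symmetric[symmetric])

lemma l1_norm_Bernstein_poly_le:
  assumes "0 \<le> x" "x \<le> 1"
  shows "l1_norm ([:1 - x, x:] ^ n) \<le> 1"
  using l1_norm_power_le[of "[:1 - x, x:]" n] assms by simp

text \<open>With \<open>N = Suc m\<close>, both sides are \<open>x * (1 - x)\<close> times the
  derivative in \<open>x\<close> of \<open>Bernstein N (Suc k)\<close>. The proof is algebraic, by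
  the absorption identities for binomial coefficients.\<close>

lemma Bernstein_first_difference:
  "real (Suc m) * (x * (1 - x)) * (Bernstein m k x - Bernstein m (Suc k) x) =
     (real (Suc k) - real (Suc m) * x) * Bernstein (Suc m) (Suc k) x"
proof (cases "k < m")
  case True
  then obtain d where d: "m = Suc (k + d)" by (metis less_iff_Suc_add)
  have 1: "real (Suc k) * real (Suc m choose Suc k) = real (Suc m) * real (m choose k)"
    using Suc_times_binomial_eq[of m k] by (metis of_nat_mult mult.commute)
  have 2: "real (Suc d) * real (Suc m choose Suc k) = real (Suc m) * real (m choose Suc k)"
  proof -
    have "Suc m choose Suc k = Suc m choose Suc d" "m choose Suc k = m choose d"
      using d binomial_symmetric[of "Suc k" "Suc m"] binomial_symmetric[of "Suc k" m] by auto
    then show ?thesis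
      using Suc_times_binomial_eq[of m d] by (metis of_nat_mult mult.commute)
  qed
  define P where "P = x ^ Suc k * (1 - x) ^ Suc d"
  have "real (Suc m) * (x * (1 - x)) * (Bernstein m k x - Bernstein m (Suc k) x) =
        (real (Suc m) * real (m choose k)) * (1 - x) * P
        - (real (Suc m) * real (m choose Suc k)) * x * P"
    unfolding Bernstein_def P_def using d by (simp add: algebra_simps)
  also have "\<dots> = (real (Suc k) * (1 - x) - real (Suc d) * x) * (real (Suc m choose Suc k) * P)"
    unfolding 1[symmetric] 2[symmetric] by (simp only: algebra_simps)
  also have "\<dots> = (real (Suc k) - real (Suc m) * x) * Bernstein (Suc m) (Suc k) x"
    unfolding Bernstein_def P_def using d by (simp add: algebra_simps)
  finally show ?thesis .
next
  case False
  show ?thesis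
  proof (cases "k = m")
    case True
    then show ?thesis by (simp add: Bernstein_def binomial_eq_0 algebra_simps)
  next
    case False
    with \<open>\<not> k < m\<close> show ?thesis by (simp add: Bernstein_def binomial_eq_0)
  qed
qed

lemma Bernstein_variance:
  "(\<Sum>k\<le>n. (real k - real n * x)\<^sup>2 * Bernstein n k x) = real n * (x * (1 - x))"
proof -
  have "(real k - real n * x)\<^sup>2 * Bernstein n k x =
      real k * (real k - 1) * Bernstein n k x + (1 - 2 * real n * x) * (real k * Bernstein n k x)
      + (real n * x)\<^sup>2 * Bernstein n k x" for k
    by (simp add: algebra_simps power2_eq_square)
  then have "(\<Sum>k\<le>n. (real k - real n * x)\<^sup>2 * Bernstein n k x) =
      real n * (real n - 1) * x\<^sup>2 + (1 - 2 * real n * x) * (real n * x) + (real n * x)\<^sup>2"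
    by (simp add: sum.distrib sum_distrib_left[symmetric])
  then show ?thesis by (simp add: algebra_simps power2_eq_square)
qed

text \<open>Cauchy-Schwarz against the variance, in the form
  \<open>\<bar>y\<bar> \<le> (y\<^sup>2 / c + c) / 2\<close> with \<open>c\<close> the standard
  deviation.\<close>

lemma Bernstein_mean_abs_deviation:
  assumes "0 < x" "x < 1" "n > 0"
  shows "(\<Sum>k\<le>n. \<bar>real k - real n * x\<bar> * Bernstein n k x) \<le> sqrt (real n * (x * (1 - x)))"
proof -
  define c where "c = sqrt (real n * (x * (1 - x)))"
  have c: "c > 0" "c\<^sup>2 = real n * (x * (1 - x))" using assms by (auto simp: c_def)
  have "\<bar>y\<bar> \<le> (y\<^sup>2 / c + c) / 2" for y
  proof -
    have "0 \<le> (\<bar>y\<bar> - c)\<^sup>2" by simp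
    then have "2 * \<bar>y\<bar> * c \<le> y\<^sup>2 + c\<^sup>2" by (simp add: power2_diff)
    then show ?thesis using c(1) by (simp add: field_simps power2_eq_square)
  qed
  then have "(\<Sum>k\<le>n. \<bar>real k - real n * x\<bar> * Bernstein n k x)
      \<le> (\<Sum>k\<le>n. ((real k - real n * x)\<^sup>2 / c + c) / 2 * Bernstein n k x)"
    using assms by (intro sum_mono mult_right_mono Bernstein_nonneg) auto
  also have "\<dots> = (\<Sum>k\<le>n. (real k - real n * x)\<^sup>2 * Bernstein n k x * (1 / (2 * c)) + c / 2 * Bernstein n k x)"
    by (intro sum.cong) (auto simp: field_simps)
  also have "\<dots> = c\<^sup>2 * (1 / (2 * c)) + c / 2"
    by (simp only: sum.distrib sum_distrib_left[symmetric] sum_distrib_right[symmetric]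
        Bernstein_variance c(2) sum_Bernstein)
  also have "\<dots> = c" using c(1) by (simp add: power2_eq_square)
  finally show ?thesis by (simp add: c_def)
qed

text \<open>After multiplication by the variance \<open>c\<^sup>2\<close>, the differences of the
  weights of degree \<open>m\<close> turn into deviations from the mean under the weights of degree
  \<open>Suc m\<close>, whose absolute mean is at most \<open>c\<close>.\<close>

lemma l1_norm_Bernstein_difference:
  assumes "0 < x" "x < 1"
  shows "l1_norm ([:1, -1:] * [:1 - x, x:] ^ m) \<le> 1 / sqrt (real (Suc m) * (x * (1 - x)))"
proof -
  define P where "P = [:1, -1:] * [:1 - x, x:] ^ m"
  define N where "N = Suc m"
  define c where "c = sqrt (real N * (x * (1 - x)))"
  have c: "c > 0" "c\<^sup>2 = real N * (x * (1 - x))" using assms by (auto simp: c_def N_def)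
  have deg: "degree P \<le> N"
    unfolding P_def N_def
    by (rule order.trans[OF degree_mult_le])
       (simp, rule order.trans[OF degree_power_le], simp)
  have P: "P = [:1 - x, x:] ^ m - pCons 0 ([:1 - x, x:] ^ m)"
    by (simp add: P_def)
  have co: "c\<^sup>2 * \<bar>coeff P k\<bar> = \<bar>real k - real N * x\<bar> * Bernstein N k x" for k
  proof (cases k)
    case 0
    then show ?thesis
      unfolding P c(2) using assms
      by (simp add: coeff_Bernstein_poly abs_mult N_def Bernstein_def)
  next
    case (Suc j)
    have "c\<^sup>2 * \<bar>coeff P k\<bar> = \<bar>- (c\<^sup>2 * coeff P k)\<bar>"
      by (simp add: abs_mult)
    also have "- (c\<^sup>2 * coeff P k) = (real k - real N * x) * Bernstein N k x"
      unfolding P c(2) N_def using Bernstein_first_difference[of m x j]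
      by (simp add: coeff_Bernstein_poly Suc algebra_simps)
    finally show ?thesis
      using Bernstein_nonneg[of x N k] assms by (simp add: abs_mult)
  qed
  have "c\<^sup>2 * l1_norm P = (\<Sum>k\<le>N. c\<^sup>2 * \<bar>coeff P k\<bar>)"
    by (simp add: l1_norm_eq_sum[OF deg] sum_distrib_left)
  also have "\<dots> \<le> c"
    unfolding co using Bernstein_mean_abs_deviation[of x N] assms by (simp add: c_def N_def)
  finally show ?thesis
    using c(1) unfolding P_def[symmetric] N_def[symmetric] c_def[symmetric]
    by (simp add: field_simps power2_eq_square)
qed

text \<open>The exponent \<open>n\<close> is split into \<open>s\<close> blocks of length
  \<open>n div s\<close> and a remainder. Each block absorbs one difference factor; the remainder
  has norm at most 1.\<close>

lemma l1_norm_Bernstein_difference_power: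
  assumes x: "0 < x" "x < 1" and "s > 0" "n > 0"
  shows "l1_norm ([:1, -1:] ^ s * [:1 - x, x:] ^ n) \<le> sqrt (real s / (real n * (x * (1 - x)))) ^ s"
proof -
  define m where "m = n div s"
  define q where "q = [:1 - x, x:]"
  have n: "n = m * s + n mod s" by (simp add: m_def)
  have "[:1, -1:] ^ s * q ^ n = ([:1, -1:] * q ^ m) ^ s * q ^ (n mod s)"
    by (subst n) (simp only: power_mult_distrib power_add power_mult mult_ac)
  then have "l1_norm ([:1, -1:] ^ s * q ^ n) \<le> l1_norm (([:1, -1:] * q ^ m) ^ s) * l1_norm (q ^ (n mod s))"
    using l1_norm_mult_le by metis
  also have "\<dots> \<le> l1_norm ([:1, -1:] * q ^ m) ^ s * 1"
    unfolding q_def using x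
    by (intro mult_mono l1_norm_power_le l1_norm_Bernstein_poly_le) auto
  also have "\<dots> \<le> sqrt (real s / (real n * (x * (1 - x)))) ^ s"
  proof -
    have "n < Suc m * s"
      using dividend_less_div_times[of s n] assms(3) by (simp add: m_def)
    then have "real n \<le> real (Suc m) * real s" by (metis less_imp_le of_nat_le_iff of_nat_mult)
    then have "real s / (real (Suc m) * real s * (x * (1 - x))) \<le> real s / (real n * (x * (1 - x)))"
      using x assms(3,4) by (intro divide_left_mono mult_right_mono) auto
    then have "1 / (real (Suc m) * (x * (1 - x))) \<le> real s / (real n * (x * (1 - x)))"
      using assms(3) by simp
    then have "1 / sqrt (real (Suc m) * (x * (1 - x))) \<le> sqrt (real s / (real n * (x * (1 - x))))"
      by (metis real_sqrt_divide real_sqrt_le_iff real_sqrt_one)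
    with l1_norm_Bernstein_difference[OF x, of m] show ?thesis
      unfolding q_def by (auto intro!: power_mono)
  qed
  finally show ?thesis by (simp add: q_def)
qed

lemma powr_minus_half_of_nat:
  assumes "y > 0"
  shows "y powr (- real s / 2) = (1 / sqrt y) ^ s"
proof -
  have "y powr (- real s / 2) = (y powr (- (1 / 2))) powr real s"
    by (simp add: powr_powr)
  also have "\<dots> = (y powr (- (1 / 2))) ^ s"
    using assms by (simp add: powr_realpow)
  also have "y powr (- (1 / 2)) = 1 / sqrt y"
    using assms by (simp add: powr_minus_divide powr_half_sqrt)
  finally show ?thesis .
qed

text \<open>Combines the trivial bound \<open>2 ^ s\<close> with the decay of order
  \<open>(n * X) powr (- s / 2)\<close>; the latter is weakened by
  \<open>X powr (- s / 2) \<le> X powr (- s)\<close>, valid as \<open>X \<le> 1\<close>.\<close>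

lemma l1_norm_Bernstein_difference_power_le:
  assumes x: "x \<in> {0..1}" and s: "s > 0" and n: "n > 0"
  shows "l1_norm ([:1, -1:] ^ s * [:1 - x, x:] ^ n)
           \<le> (2 ^ s + sqrt (real s) ^ s) * endpoint_term s n (x * (1 - x))"
proof -
  define l where "l = l1_norm ([:1, -1:] ^ s * [:1 - x, x:] ^ n)"
  define X where "X = x * (1 - x)"
  have "l \<le> l1_norm ([:1, -1:] ^ s) * l1_norm ([:1 - x, x:] ^ n)"
    unfolding l_def by (rule l1_norm_mult_le)
  also have "\<dots> \<le> 2 ^ s * 1"
    using l1_norm_power_le[of "[:1, -1:]" s] x
    by (intro mult_mono l1_norm_Bernstein_poly_le) auto
  finally have l1: "l \<le> 2 ^ s" by simp
  show ?thesis
  proof (cases "X = 0")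
    case True
    then show ?thesis
      using l1 by (simp add: endpoint_term_def X_def[symmetric] l_def[symmetric] add_increasing2)
  next
    case False
    with x have x': "0 < x" "x < 1" by (auto simp: X_def less_le)
    have X: "0 < X" "X \<le> 1" using x' by (auto simp: X_def mult_le_one)
    define T where "T = X powr (- real s) * real n powr (- real s / 2)"
    have T0: "T > 0" using X n by (simp add: T_def)
    have "l \<le> sqrt (real s / (real n * X)) ^ s"
      unfolding l_def X_def by (rule l1_norm_Bernstein_difference_power[OF x' s n])
    also have "\<dots> = sqrt (real s) ^ s * (X powr (- real s / 2) * real n powr (- real s / 2))"
    proof -
      have "X powr (- real s / 2) = (1 / sqrt X) ^ s" "real n powr (- real s / 2) = (1 / sqrt (real n)) ^ s"
        using X n by (simp_all only: powr_minus_half_of_nat of_nat_0_less_iff)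
      then show ?thesis
        by (simp only: real_sqrt_divide real_sqrt_mult power_divide power_mult_distrib) simp
    qed
    also have "\<dots> \<le> sqrt (real s) ^ s * T"
      unfolding T_def using X s
      by (intro mult_left_mono mult_right_mono) (auto intro!: powr_mono')
    finally have l2: "l \<le> sqrt (real s) ^ s * T" .
    have "l \<le> (2 ^ s + sqrt (real s) ^ s) * min 1 T"
    proof (cases "1 \<le> T")
      case True
      then have "min 1 T = 1" by simp
      then show ?thesis using l1 by (simp add: add_increasing2)
    next
      case False
      then have "min 1 T = T" by simp
      then show ?thesis using l2 T0 by (simp add: distrib_right add_increasing)
    qed
    then show ?thesis
      using False by (simp add: endpoint_term_def X_def[symmetric] l_def[symmetric] T_def)
  qed
qed

text \<open>Reflecting \<open>k\<close> to \<open>n - k\<close> turns the sum into a convolution.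
  Summation by parts then amounts to associativity of multiplication.\<close>

lemma sum_Bernstein_eq_fps_nth:
  "(\<Sum>k\<le>n. fps_nth D k * Bernstein n k x) = fps_nth (fps_of_poly ([:x, 1 - x:] ^ n) * D) n"
proof -
  have "(\<Sum>k\<le>n. fps_nth D k * Bernstein n k x) =
        (\<Sum>k\<le>n. fps_nth D k * coeff ([:1 - (1 - x), 1 - x:] ^ n) (n - k))"
    unfolding coeff_Bernstein_poly by (intro sum.cong) (auto simp: Bernstein_reflect)
  also have "1 - (1 - x) = x"
    by simp
  also have "(\<Sum>k\<le>n. fps_nth D k * coeff ([:x, 1 - x:] ^ n) (n - k)) =
      fps_nth (D * fps_of_poly ([:x, 1 - x:] ^ n)) n"
    by (simp only: fps_mult_nth atMost_atLeast0 fps_of_poly_nth)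
  finally show ?thesis by (simp only: mult.commute)
qed

lemma sigma_delta_Bernstein:
  assumes s: "s > 0" and \<nu>: "\<nu> < 1"
  obtains K where "K > 0"
    "\<And>n a. n > 0 \<Longrightarrow> (\<And>k. k \<le> n \<Longrightarrow> \<bar>a k\<bar> \<le> \<nu>) \<Longrightarrow>
       \<exists>\<sigma>::nat \<Rightarrow> real. (\<forall>k\<le>n. \<sigma> k \<in> {-1, 1}) \<and>
         (\<forall>x\<in>{0..1}. \<bar>(\<Sum>k\<le>n. a k * Bernstein n k x) - (\<Sum>k\<le>n. \<sigma> k * Bernstein n k x)\<bar>
            \<le> K * endpoint_term s n (x * (1 - x)))"
proof -
  obtain H g where H: "poly H 0 = 0" "1 - H = [:1, -1:] ^ s * g" "l1_norm H \<le> 2 - \<nu>"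
    using ex_sigma_delta_filter[of s "2 - \<nu>"] s \<nu> by auto
  define K where "K = (1 + l1_norm g) * (2 ^ s + sqrt (real s) ^ s)"
  show ?thesis
  proof
    show "K > 0" unfolding K_def
      by (intro mult_pos_pos add_pos_nonneg) auto
  next
    fix n :: nat and a :: "nat \<Rightarrow> real"
    assume n: "n > 0" and a: "\<And>k. k \<le> n \<Longrightarrow> \<bar>a k\<bar> \<le> \<nu>"
    define b where "b = (\<lambda>k. if k \<le> n then a k else 0)"
    \<comment> \<open>The bound on \<open>a 0\<close> shows that \<open>\<nu>\<close> is
      nonnegative, as the zero tail of \<open>b\<close> requires.\<close>
    have b: "\<bar>b k\<bar> \<le> \<nu>" for k
      using a[of k] a[of 0] by (auto simp: b_def)
    obtain \<sigma> V where *: "\<And>k. \<sigma> k \<in> {-1, 1}" "\<And>k. \<bar>fps_nth V k\<bar> \<le> 1"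
      "Abs_fps (\<lambda>k. b k - \<sigma> k) = fps_of_poly (1 - H) * V"
      using sigma_delta_stable[where a = b, OF H(1,3) b] by blast
    have "\<bar>(\<Sum>k\<le>n. a k * Bernstein n k x) - (\<Sum>k\<le>n. \<sigma> k * Bernstein n k x)\<bar>
            \<le> K * endpoint_term s n (x * (1 - x))" if x: "x \<in> {0..1}" for x
    proof -
      define Q where "Q = [:x, 1 - x:] ^ n"
      have "(\<Sum>k\<le>n. a k * Bernstein n k x) - (\<Sum>k\<le>n. \<sigma> k * Bernstein n k x) =
          (\<Sum>k\<le>n. fps_nth (Abs_fps (\<lambda>k. b k - \<sigma> k)) k * Bernstein n k x)"
        by (simp add: sum_subtractf[symmetric] b_def left_diff_distrib)
      \<comment> \<open>The factor \<open>[:1, -1:] ^ s\<close> of \<open>1 - H\<close> passes from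
        \<open>V\<close> to the Bernstein weights; no boundary terms arise in this form.\<close>
      also have "\<dots> = fps_nth (fps_of_poly (g * ([:1, -1:] ^ s * Q)) * V) n"
        unfolding sum_Bernstein_eq_fps_nth *(3) H(2) Q_def
        by (simp only: fps_of_poly_mult mult_ac)
      also have "\<bar>\<dots>\<bar> \<le> l1_norm (g * ([:1, -1:] ^ s * Q)) * 1"
        by (rule fps_mult_nth_le_l1_norm) (rule *(2))
      also have "\<dots> \<le> l1_norm g * l1_norm ([:1, -1:] ^ s * Q)"
        using l1_norm_mult_le by simp
      \<comment> \<open>\<open>Q\<close> carries the weights in reversed order, hence the bound is
        taken at \<open>1 - x\<close>, which has the same \<open>X\<close>.\<close>
      also have "l1_norm ([:1, -1:] ^ s * Q) \<le> (2 ^ s + sqrt (real s) ^ s) * endpoint_term s n (x * (1 - x))"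
        using l1_norm_Bernstein_difference_power_le[of "1 - x" s n] x s n
        by (simp add: Q_def mult.commute)
      also have "l1_norm g * \<dots> \<le> (1 + l1_norm g) * \<dots>"
        by (intro mult_right_mono) (auto simp: endpoint_term_def)
      finally show ?thesis by (simp add: K_def mult.assoc mult_left_mono)
    qed
    with *(1) show "\<exists>\<sigma>::nat \<Rightarrow> real. (\<forall>k\<le>n. \<sigma> k \<in> {-1, 1}) \<and>
         (\<forall>x\<in>{0..1}. \<bar>(\<Sum>k\<le>n. a k * Bernstein n k x) - (\<Sum>k\<le>n. \<sigma> k * Bernstein n k x)\<bar>
            \<le> K * endpoint_term s n (x * (1 - x)))"
      by blast
  qed
qed

subsection \<open>Bernstein coefficients of a polynomial\<close>

text \<open>For \<open>degree q \<le> n\<close> this is the coefficient of \<open>q\<close> at index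
  \<open>k\<close> in the Bernstein basis of degree \<open>n\<close>. Monomials of degree above
  \<open>n\<close> contribute 0, by division by zero.\<close>

definition Bernstein_coeff :: "nat \<Rightarrow> nat \<Rightarrow> real poly \<Rightarrow> real" where
  "Bernstein_coeff n k q = (\<Sum>m\<le>degree q. coeff q m * (real (k choose m) / real (n choose m)))"

lemma Bernstein_coeff_altdef:
  assumes "degree q \<le> N"
  shows "Bernstein_coeff n k q = (\<Sum>m\<le>N. coeff q m * (real (k choose m) / real (n choose m)))"
  unfolding Bernstein_coeff_def using assms
  by (intro sum.mono_neutral_left) (auto simp: coeff_eq_0)

lemma Bernstein_coeff_add:
  "Bernstein_coeff n k (p + q) = Bernstein_coeff n k p + Bernstein_coeff n k q"
proof -
  define N where "N = max (degree p) (degree q)"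
  have "degree (p + q) \<le> N" "degree p \<le> N" "degree q \<le> N"
    by (auto simp: N_def intro: degree_add_le)
  then show ?thesis
    by (simp add: Bernstein_coeff_altdef[where N = N] sum.distrib distrib_right add_divide_distrib)
qed

lemma Bernstein_coeff_smult: "Bernstein_coeff n k (smult c q) = c * Bernstein_coeff n k q"
  by (simp add: Bernstein_coeff_altdef[where N = "degree q"] sum_distrib_left mult.assoc)

lemma Bernstein_coeff_0 [simp]: "Bernstein_coeff n k 0 = 0"
  by (simp add: Bernstein_coeff_def)

lemma Bernstein_coeff_1 [simp]: "Bernstein_coeff n k 1 = 1"
  by (simp add: Bernstein_coeff_def)

lemma Bernstein_coeff_diff:
  "Bernstein_coeff n k (p - q) = Bernstein_coeff n k p - Bernstein_coeff n k q"
  using Bernstein_coeff_add[of n k "p - q" q] by simp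

lemma Bernstein_coeff_sum:
  "Bernstein_coeff n k (\<Sum>i\<in>I. p i) = (\<Sum>i\<in>I. Bernstein_coeff n k (p i))"
  by (induction I rule: infinite_finite_induct) (simp_all add: Bernstein_coeff_add)

lemma Bernstein_coeff_monom:
  "Bernstein_coeff n k (monom c m) = c * (real (k choose m) / real (n choose m))"
proof -
  have "Bernstein_coeff n k (monom c m) =
      (\<Sum>i\<le>m. if i = m then c * (real (k choose i) / real (n choose i)) else 0)"
    unfolding Bernstein_coeff_altdef[OF degree_monom_le] by (intro sum.cong) auto
  then show ?thesis by simp
qed

lemma Suc_times_choose_Suc: "real (Suc m) * real (k choose Suc m) = (real k - real m) * real (k choose m)"
proof (cases "m \<le> k")
  case True
  have "Suc m * (k choose Suc m) = (k - m) * (k choose m)"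
    using binomial_absorption[of m k] binomial_absorb_comp[of k m] by simp
  then have "real (Suc m) * real (k choose Suc m) = real (k - m) * real (k choose m)"
    by (metis of_nat_mult)
  then show ?thesis using True by (simp add: of_nat_diff)
qed (simp add: binomial_eq_0)

text \<open>The dual of the differential equation \<open>x (1 - x) B' = (k - n x) B\<close> for \<open>B = Bernstein n k\<close>.\<close>

lemma Bernstein_coeff_recursion:
  assumes "k \<le> n"
  shows "Bernstein_coeff n k ([:- real k, real n:] * q) = - Bernstein_coeff n k ([:0, 1, -1:] * pderiv q)"
proof -
  have monom: "Bernstein_coeff n k ([:- real k, real n:] * monom c m) =
      - Bernstein_coeff n k ([:0, 1, -1:] * pderiv (monom c m))" for c m
  proof -
    define K where "K = (\<lambda>m. real (k choose m) / real (n choose m))"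
    \<comment> \<open>The ratio of consecutive binomial quotients. For \<open>m \<ge> n\<close> both
      sides vanish, by \<open>k \<le> n\<close>.\<close>
    have K: "(real n - real m) * K (Suc m) = (real k - real m) * K m"
    proof (cases "m < n")
      case True
      then have "real (n choose m) \<noteq> 0" "real (n choose Suc m) \<noteq> 0" "real n - real m \<noteq> 0"
        by auto
      then show ?thesis
        using Suc_times_choose_Suc[of m k] Suc_times_choose_Suc[of m n]
        unfolding K_def
        by (simp add: divide_simps) (metis (no_types) mult.commute mult.left_commute mult_cancel_left of_nat_eq_0_iff nat.distinct(1) of_nat_Suc)
    next
      case False
      then show ?thesis using assms by (cases "m = k") (auto simp: K_def binomial_eq_0)
    qed
    have 1: "[:- real k, real n:] * monom c m = smult (- real k) (monom c m) + smult (real n) (monom c (Suc m))"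
      by (simp add: monom_Suc)
    have 2: "[:0, 1, -1:] * pderiv (monom c m) = smult (real m) (monom c m) - smult (real m) (monom c (Suc m))"
    proof (cases m)
      case 0
      then show ?thesis by (simp add: monom_0)
    next
      case (Suc i)
      have "pderiv (monom c (Suc i)) = smult (real (Suc i)) (monom c i)"
        by (simp add: pderiv_monom smult_monom del: of_nat_Suc)
      moreover have "[:0, 1, -1:] * monom c i = monom c (Suc i) - monom c (Suc (Suc i))"
        by (simp add: monom_Suc)
      ultimately show ?thesis
        unfolding Suc by (simp only: mult_smult_right smult_diff_right)
    qed
    have "Bernstein_coeff n k (monom c m) = c * K m" for c m
      by (simp add: Bernstein_coeff_monom K_def)
    then show ?thesis
      unfolding 1 2 Bernstein_coeff_add Bernstein_coeff_diff Bernstein_coeff_smult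
      using arg_cong[OF K, of "\<lambda>t. c * t"] by (simp add: algebra_simps)
  qed
  have q: "q = (\<Sum>i\<le>degree q. monom (coeff q i) i)"
    by (simp add: poly_as_sum_of_monoms)
  have pderiv_sum: "pderiv (\<Sum>i\<in>I. p i) = (\<Sum>i\<in>I. pderiv (p i))" for p :: "nat \<Rightarrow> real poly" and I
    by (induction I rule: infinite_finite_induct) (simp_all add: pderiv_add)
  show ?thesis
    by (subst (1 2) q)
       (simp only: pderiv_sum sum_distrib_left Bernstein_coeff_sum monom sum_negf)
qed

text \<open>Trinomial revision, \<open>(n choose k) * (k choose m) = (n choose m) * ((n - m) choose
  (k - m))\<close>, leaves \<open>x ^ m\<close> times the partition of unity of degree
  \<open>n - m\<close>.\<close>

lemma sum_choose_Bernstein: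
  assumes "m \<le> n"
  shows "(\<Sum>k\<le>n. real (k choose m) / real (n choose m) * Bernstein n k x) = x ^ m"
proof -
  have "(\<Sum>k\<le>n. real (k choose m) / real (n choose m) * Bernstein n k x) =
        (\<Sum>k\<in>{m..n}. real (k choose m) / real (n choose m) * Bernstein n k x)"
    by (rule sum.mono_neutral_right) auto
  also have "\<dots> = (\<Sum>k\<in>{m..n}. x ^ m * Bernstein (n - m) (k - m) x)"
  proof (rule sum.cong[OF refl])
    fix k assume k: "k \<in> {m..n}"
    have "real (n choose k) * real (k choose m) = real (n choose m) * real ((n - m) choose (k - m))"
      using choose_mult[of m k n] k by (metis atLeastAtMost_iff of_nat_mult)
    moreover have "real (n choose m) \<noteq> 0" using assms by simp
    moreover have "x ^ k = x ^ m * x ^ (k - m)" using k by (simp flip: power_add)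
    moreover have "n - m - (k - m) = n - k" using k by auto
    ultimately show "real (k choose m) / real (n choose m) * Bernstein n k x = x ^ m * Bernstein (n - m) (k - m) x"
      unfolding Bernstein_def by (simp add: divide_simps) (metis mult.assoc mult.commute)
  qed
  also have "\<dots> = (\<Sum>i\<le>n - m. x ^ m * Bernstein (n - m) i x)"
    using assms by (intro sum.reindex_bij_witness[of _ "\<lambda>i. i + m" "\<lambda>k. k - m"]) auto
  also have "\<dots> = x ^ m" by (simp flip: sum_distrib_left)
  finally show ?thesis .
qed

lemma sum_Bernstein_coeff:
  assumes "degree q \<le> n"
  shows "(\<Sum>k\<le>n. Bernstein_coeff n k q * Bernstein n k x) = poly q x"
proof -
  have "(\<Sum>k\<le>n. Bernstein_coeff n k q * Bernstein n k x) =
     (\<Sum>k\<le>n. \<Sum>m\<le>degree q. coeff q m * (real (k choose m) / real (n choose m) * Bernstein n k x))"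
    by (simp add: Bernstein_coeff_def sum_distrib_right mult.assoc)
  also have "\<dots> = (\<Sum>m\<le>degree q. coeff q m * (\<Sum>k\<le>n. real (k choose m) / real (n choose m) * Bernstein n k x))"
    by (subst sum.swap) (simp add: sum_distrib_left)
  also have "\<dots> = (\<Sum>m\<le>degree q. coeff q m * x ^ m)"
    using assms by (intro sum.cong refl arg_cong2[where f = "(*)"] sum_choose_Bernstein) auto
  finally show ?thesis by (simp add: poly_altdef)
qed

definition local_power :: "nat \<Rightarrow> nat \<Rightarrow> nat \<Rightarrow> real poly" where
  "local_power n k j = [:- (real k / real n), 1:] ^ j"

text \<open>The recursion for the power \<open>Suc j\<close> of \<open>y - t\<close>, with
  \<open>y * (1 - y)\<close> expanded around the node as
  \<open>t * (1 - t) + (1 - 2 * t) * (y - t) - (y - t)\<^sup>2\<close>.\<close>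

lemma Bernstein_coeff_local_power_step:
  assumes "k \<le> n" "n > 0"
  defines "t \<equiv> real k / real n"
  shows "real n * Bernstein_coeff n k (local_power n k (Suc (Suc j))) =
     - real (Suc j) * (t * (1 - t) * Bernstein_coeff n k (local_power n k j)
        + (1 - 2 * t) * Bernstein_coeff n k (local_power n k (Suc j))
        - Bernstein_coeff n k (local_power n k (Suc (Suc j))))"
proof -
  define P where "P = [:- t, 1:]"
  have lp: "local_power n k j = P ^ j" for j
    by (simp add: local_power_def P_def t_def)
  have 1: "[:- real k, real n:] = smult (real n) P"
    using assms(2) by (simp add: P_def t_def)
  have "pderiv (P ^ Suc j) = smult (real (Suc j)) (P ^ j)"
    unfolding pderiv_power_Suc by (simp add: P_def pderiv_pCons)
  moreover
  have quad: "[:0, 1, -1:] = [:t * (1 - t):] + smult (1 - 2 * t) P - P * P"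
    by (simp add: P_def algebra_simps)
  have "[:0, 1, -1:] * P ^ j = smult (t * (1 - t)) (P ^ j) + smult (1 - 2 * t) (P ^ Suc j) - P ^ Suc (Suc j)"
    unfolding quad by (simp add: left_diff_distrib distrib_right mult.assoc)
  ultimately have 2: "[:0, 1, -1:] * pderiv (P ^ Suc j) =
      smult (real (Suc j)) (smult (t * (1 - t)) (P ^ j) + smult (1 - 2 * t) (P ^ Suc j) - P ^ Suc (Suc j))"
    by (simp only: mult_smult_right)
  have "real n * Bernstein_coeff n k (P ^ Suc (Suc j)) = Bernstein_coeff n k ([:- real k, real n:] * P ^ Suc j)"
    unfolding 1 by (simp add: Bernstein_coeff_smult)
  also have "\<dots> = - Bernstein_coeff n k ([:0, 1, -1:] * pderiv (P ^ Suc j))"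
    by (rule Bernstein_coeff_recursion) (rule assms)
  also have "\<dots> = - real (Suc j) * (t * (1 - t) * Bernstein_coeff n k (P ^ j)
      + (1 - 2 * t) * Bernstein_coeff n k (P ^ Suc j) - Bernstein_coeff n k (P ^ Suc (Suc j)))"
    unfolding 2 Bernstein_coeff_smult Bernstein_coeff_add Bernstein_coeff_diff
    by (simp only: minus_mult_left)
  finally show ?thesis unfolding lp .
qed

text \<open>Two-step induction. The power \<open>Suc (Suc j)\<close> occurs on both sides of the
  recursion; collecting it leaves the factor \<open>n - Suc j\<close>, at least
  \<open>n / 2\<close>, so that each double step gains \<open>1 / n\<close>.\<close>

lemma Bernstein_coeff_local_power_bound_aux:
  "\<exists>K\<ge>0. \<forall>n k. n > 0 \<and> 2 * j \<le> n \<and> k \<le> n \<longrightarrow>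
     \<bar>Bernstein_coeff n k (local_power n k j)\<bar> \<le> K * (1 / sqrt (real n)) ^ j"
proof (induction j rule: induct_nat_012)
  case 0
  then show ?case by (intro exI[of _ 1]) (simp add: local_power_def)
next
  case 1
  \<comment> \<open>The identity function has the Bernstein coefficients \<open>k / n\<close>, which
    the centering cancels.\<close>
  have "Bernstein_coeff n k (local_power n k 1) = 0" if "n > 0" for n k
    using that by (simp add: local_power_def Bernstein_coeff_def)
  then show ?case by (intro exI[of _ 1]) (simp add: local_power_def)
next
  case (ge2 j)
  obtain K0 where K0: "K0 \<ge> 0" "\<And>n k. n > 0 \<Longrightarrow> 2 * j \<le> n \<Longrightarrow> k \<le> n \<Longrightarrow>
     \<bar>Bernstein_coeff n k (local_power n k j)\<bar> \<le> K0 * (1 / sqrt (real n)) ^ j"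
    using ge2(1) by blast
  obtain K1 where K1: "K1 \<ge> 0" "\<And>n k. n > 0 \<Longrightarrow> 2 * Suc j \<le> n \<Longrightarrow> k \<le> n \<Longrightarrow>
     \<bar>Bernstein_coeff n k (local_power n k (Suc j))\<bar> \<le> K1 * (1 / sqrt (real n)) ^ Suc j"
    using ge2(2) by blast
  define K where "K = 2 * real (Suc j) * (K0 + K1)"
  have "\<bar>Bernstein_coeff n k (local_power n k (Suc (Suc j)))\<bar> \<le> K * (1 / sqrt (real n)) ^ Suc (Suc j)"
    if n: "n > 0" "2 * Suc (Suc j) \<le> n" "k \<le> n" for n k
  proof -
    define t where "t = real k / real n"
    define r where "r = 1 / sqrt (real n)"
    define b where "b = (\<lambda>j. Bernstein_coeff n k (local_power n k j))"
    have r: "r > 0" "r \<le> 1" "real n * r ^ 2 = 1"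
      using n by (auto simp: r_def power_divide)
    have t: "0 \<le> t" "t \<le> 1" using n by (auto simp: t_def)
    have b0: "\<bar>b j\<bar> \<le> K0 * r ^ j" unfolding b_def r_def using K0(2)[of n k] n by simp
    have "\<bar>b (Suc j)\<bar> \<le> K1 * r ^ Suc j" unfolding b_def r_def using K1(2)[of n k] n by simp
    also have "\<dots> \<le> K1 * r ^ j"
      using r K1(1) by (intro mult_left_mono) (auto simp: mult_left_le_one_le)
    finally have b1: "\<bar>b (Suc j)\<bar> \<le> K1 * r ^ j" .
    have "(real n - real (Suc j)) * b (Suc (Suc j)) =
        - real (Suc j) * (t * (1 - t) * b j + (1 - 2 * t) * b (Suc j))"
      using Bernstein_coeff_local_power_step[of k n j] n
      unfolding b_def t_def by (simp add: algebra_simps)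
    then have "\<bar>(real n - real (Suc j)) * b (Suc (Suc j))\<bar> =
        real (Suc j) * \<bar>t * (1 - t) * b j + (1 - 2 * t) * b (Suc j)\<bar>"
      by (simp add: abs_mult)
    moreover have "\<bar>t * (1 - t) * b j + (1 - 2 * t) * b (Suc j)\<bar> \<le> \<bar>b j\<bar> + \<bar>b (Suc j)\<bar>"
    proof -
      have "\<bar>t * (1 - t)\<bar> \<le> 1" "\<bar>1 - 2 * t\<bar> \<le> 1"
        using t by (auto simp: abs_mult mult_le_one)
      then have "\<bar>t * (1 - t) * b j\<bar> \<le> \<bar>b j\<bar>" "\<bar>(1 - 2 * t) * b (Suc j)\<bar> \<le> \<bar>b (Suc j)\<bar>"
        by (simp_all only: abs_mult[of "t * (1 - t)"] abs_mult[of "1 - 2 * t"] mult_left_le_one_le abs_ge_zero)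
      then show ?thesis by linarith
    qed
    ultimately have "\<bar>(real n - real (Suc j)) * b (Suc (Suc j))\<bar> \<le> real (Suc j) * ((K0 + K1) * r ^ j)"
      using b0 b1 by (simp add: distrib_right mult_left_mono del: of_nat_Suc)
    moreover have "real n / 2 * \<bar>b (Suc (Suc j))\<bar> \<le> \<bar>(real n - real (Suc j)) * b (Suc (Suc j))\<bar>"
    proof -
      have "real n / 2 \<le> real n - real (Suc j)" using of_nat_mono[OF n(2), where 'a = real] by simp
      then have "real n / 2 \<le> \<bar>real n - real (Suc j)\<bar>" by linarith
      then show ?thesis unfolding abs_mult by (rule mult_right_mono) simp
    qed
    ultimately have "real n / 2 * \<bar>b (Suc (Suc j))\<bar> \<le> real (Suc j) * ((K0 + K1) * r ^ j)"
      by linarith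
    then have "(2 * r ^ 2) * (real n / 2 * \<bar>b (Suc (Suc j))\<bar>) \<le> (2 * r ^ 2) * (real (Suc j) * ((K0 + K1) * r ^ j))"
      by (rule mult_left_mono) simp
    moreover have "(2 * r ^ 2) * (real n / 2 * \<bar>b (Suc (Suc j))\<bar>) = \<bar>b (Suc (Suc j))\<bar>"
      using r(3) by (simp add: field_simps)
    moreover have "(2 * r ^ 2) * (real (Suc j) * ((K0 + K1) * r ^ j)) = K * r ^ Suc (Suc j)"
      by (simp add: K_def power2_eq_square algebra_simps)
    ultimately have "\<bar>b (Suc (Suc j))\<bar> \<le> K * r ^ Suc (Suc j)" by (simp only:)
    then show ?thesis by (simp only: b_def r_def)
  qed
  moreover have "K \<ge> 0" using K0 K1 by (simp add: K_def)
  ultimately show ?case by blast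
qed

lemma Bernstein_coeff_local_power_bound:
  obtains K where "K \<ge> 0" "\<And>n k j. j \<le> m \<Longrightarrow> n > 0 \<Longrightarrow> 2 * m \<le> n \<Longrightarrow> k \<le> n \<Longrightarrow>
     \<bar>Bernstein_coeff n k (local_power n k j)\<bar> \<le> K * (1 / sqrt (real n)) ^ j"
proof -
  obtain K where K: "\<And>j. K j \<ge> 0" "\<And>j n k. n > 0 \<Longrightarrow> 2 * j \<le> n \<Longrightarrow> k \<le> n \<Longrightarrow>
     \<bar>Bernstein_coeff n k (local_power n k j)\<bar> \<le> K j * (1 / sqrt (real n)) ^ j"
    using Bernstein_coeff_local_power_bound_aux by metis
  show ?thesis
  proof
    show "(\<Sum>j\<le>m. K j) \<ge> 0" using K(1) by (simp add: sum_nonneg)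
  next
    fix n k j assume *: "j \<le> m" "n > 0" "2 * m \<le> n" "k \<le> n"
    then have "\<bar>Bernstein_coeff n k (local_power n k j)\<bar> \<le> K j * (1 / sqrt (real n)) ^ j"
      by (intro K(2)) auto
    also have "\<dots> \<le> (\<Sum>j\<le>m. K j) * (1 / sqrt (real n)) ^ j"
      using * K(1) by (intro mult_right_mono member_le_sum) auto
    finally show "\<bar>Bernstein_coeff n k (local_power n k j)\<bar> \<le> (\<Sum>j\<le>m. K j) * (1 / sqrt (real n)) ^ j" .
  qed
qed

subsection \<open>Absolute moments of the Bernstein weights\<close>

lemma exp_le_quadratic:
  fixes y :: real
  assumes "\<bar>y\<bar> \<le> 1"
  shows "exp y \<le> 1 + y + y\<^sup>2"
proof (cases "y \<ge> 0")
  case True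
  with assms show ?thesis by (intro exp_bound) auto
next
  case False
  define u where "u = - y"
  have u: "u > 0" "u \<le> 1" using False assms by (auto simp: u_def)
  have "exp y = 1 / exp u" by (simp add: u_def exp_minus divide_inverse)
  also have "\<dots> \<le> 1 / (1 + u)"
    using u exp_ge_add_one_self[of u] by (intro divide_left_mono) auto
  also have "\<dots> \<le> 1 - u + u\<^sup>2"
  proof -
    have "(1 - u + u\<^sup>2) * (1 + u) = 1 + u ^ 3"
      by (simp add: algebra_simps power2_eq_square power3_eq_cube)
    then show ?thesis using u by (simp add: divide_le_eq)
  qed
  finally show ?thesis by (simp add: u_def)
qed

lemma power_le_fact_exp_abs: "\<bar>y\<bar> ^ i \<le> fact i * exp \<bar>y\<bar>" for y :: real
proof -
  have "\<bar>y\<bar> ^ i / fact i = (\<Sum>n\<in>{i}. \<bar>y\<bar> ^ n /\<^sub>R fact n)"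
    by (simp add: divide_inverse mult.commute)
  also have "\<dots> \<le> (\<Sum>n. \<bar>y\<bar> ^ n /\<^sub>R fact n)"
    by (intro sum_le_suminf summable_exp_generic) auto
  finally show ?thesis by (simp add: exp_def field_simps)
qed

text \<open>The moment generating function of a sum of \<open>n\<close> independent centered
  Bernoulli variables factorizes by the binomial theorem. In each factor the linear terms cancel,
  leaving at most \<open>1 + \<theta>\<^sup>2\<close>.\<close>

lemma Bernstein_mgf_le:
  assumes x: "x \<in> {0..1}" and \<theta>: "\<bar>\<theta>\<bar> \<le> 1"
  shows "(\<Sum>k\<le>n. Bernstein n k x * exp (\<theta> * (real k - real n * x))) \<le> exp (real n * \<theta>\<^sup>2)"
proof -
  define a where "a = x * exp (\<theta> * (1 - x))"
  define b where "b = (1 - x) * exp (- \<theta> * x)"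
  have "(\<Sum>k\<le>n. Bernstein n k x * exp (\<theta> * (real k - real n * x))) = (a + b) ^ n"
    unfolding binomial_ring
  proof (rule sum.cong[OF refl])
    fix k assume "k \<in> {..n}"
    then have k: "real (n - k) = real n - real k" by (simp add: of_nat_diff)
    have "exp (\<theta> * (real k - real n * x)) = exp (\<theta> * (1 - x)) ^ k * exp (- \<theta> * x) ^ (n - k)"
      unfolding exp_of_nat_mult[symmetric] exp_add[symmetric] k
      by (rule arg_cong[where f = exp]) (simp add: algebra_simps)
    then show "Bernstein n k x * exp (\<theta> * (real k - real n * x)) = of_nat (n choose k) * a ^ k * b ^ (n - k)"
      by (simp add: Bernstein_def a_def b_def power_mult_distrib)
  qed
  also have "a + b \<le> exp (\<theta>\<^sup>2)"
  proof -
    have "\<bar>\<theta> * (1 - x)\<bar> \<le> 1" "\<bar>- \<theta> * x\<bar> \<le> 1"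
      using x \<theta> by (auto simp: abs_mult intro!: mult_le_one)
    then have "a + b \<le> x * (1 + \<theta> * (1 - x) + (\<theta> * (1 - x))\<^sup>2) + (1 - x) * (1 + (- \<theta> * x) + (- \<theta> * x)\<^sup>2)"
      unfolding a_def b_def using x by (intro add_mono mult_left_mono exp_le_quadratic) auto
    also have "\<dots> = 1 + x * (1 - x) * \<theta>\<^sup>2"
      by (simp add: algebra_simps power2_eq_square)
    also have "\<dots> \<le> 1 + 1 * \<theta>\<^sup>2"
      using x by (intro add_left_mono mult_right_mono mult_le_one) auto
    also have "\<dots> \<le> exp (\<theta>\<^sup>2)" using exp_ge_add_one_self[of "\<theta>\<^sup>2"] by simp
    finally show ?thesis .
  qed
  then have "(a + b) ^ n \<le> exp (\<theta>\<^sup>2) ^ n"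
    using x by (intro power_mono) (auto simp: a_def b_def)
  also have "\<dots> = exp (real n * \<theta>\<^sup>2)" by (simp add: exp_of_nat_mult)
  finally show ?thesis .
qed

text \<open>With \<open>y\<close> the deviation \<open>k - n * x\<close> scaled by
  \<open>1 / sqrt n\<close>, \<open>\<bar>y\<bar> ^ i\<close> is at most
  \<open>fact i * (exp y + exp (- y))\<close>. Each exponential has mean at most
  \<open>exp 1 \<le> 3\<close>, hence the 6.\<close>

lemma Bernstein_abs_moment_le:
  assumes x: "x \<in> {0..1}" and n: "n > 0"
  shows "(\<Sum>k\<le>n. \<bar>real k / real n - x\<bar> ^ i * Bernstein n k x) \<le> 6 * fact i * (1 / sqrt (real n)) ^ i"
proof -
  define r where "r = 1 / sqrt (real n)"
  have r: "r > 0" "r \<le> 1" "real n * r\<^sup>2 = 1" using n by (auto simp: r_def power_divide)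
  have step: "\<bar>real k / real n - x\<bar> ^ i \<le>
      r ^ i * (fact i * (exp (r * (real k - real n * x)) + exp (- r * (real k - real n * x))))" for k
  proof -
    define y where "y = r * (real k - real n * x)"
    have "real k / real n - x = (real k - real n * x) / real n"
      using n by (simp add: field_simps)
    also have "\<dots> = (real k - real n * x) * (1 / real n)"
      by simp
    also have "1 / real n = r * r"
      using n by (simp add: r_def)
    also have "(real k - real n * x) * (r * r) = r * y"
      by (simp add: y_def)
    finally have "\<bar>real k / real n - x\<bar> ^ i = r ^ i * \<bar>y\<bar> ^ i"
      using r by (simp add: abs_mult power_mult_distrib)
    also have "\<dots> \<le> r ^ i * (fact i * exp \<bar>y\<bar>)"
      using r by (intro mult_left_mono power_le_fact_exp_abs) auto
    also have "\<dots> \<le> r ^ i * (fact i * (exp y + exp (- y)))"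
      using r by (intro mult_left_mono) (auto simp: abs_if)
    finally show ?thesis by (simp add: y_def)
  qed
  have "(\<Sum>k\<le>n. \<bar>real k / real n - x\<bar> ^ i * Bernstein n k x) \<le>
     (\<Sum>k\<le>n. r ^ i * (fact i * (exp (r * (real k - real n * x)) + exp (- r * (real k - real n * x)))) * Bernstein n k x)"
    using x by (intro sum_mono mult_right_mono step Bernstein_nonneg) auto
  also have "\<dots> = r ^ i * fact i * ((\<Sum>k\<le>n. Bernstein n k x * exp (r * (real k - real n * x)))
      + (\<Sum>k\<le>n. Bernstein n k x * exp (- r * (real k - real n * x))))"
    by (simp add: sum_distrib_left sum.distrib[symmetric] algebra_simps)
  also have "\<dots> \<le> r ^ i * fact i * (3 + 3)"
  proof (intro mult_left_mono add_mono)
    have "exp (1::real) \<le> 3" by (rule exp_le)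
    then show "(\<Sum>k\<le>n. Bernstein n k x * exp (r * (real k - real n * x))) \<le> 3"
      "(\<Sum>k\<le>n. Bernstein n k x * exp (- r * (real k - real n * x))) \<le> 3"
      using Bernstein_mgf_le[OF x, of r n] Bernstein_mgf_le[OF x, of "- r" n] r by simp_all
  qed (use r in auto)
  finally show ?thesis by (simp add: r_def mult_ac)
qed

subsection \<open>Taylor expansion on the unit interval\<close>

text \<open>\<open>D l\<close> stands for the derivative of order \<open>l\<close>. Passing a
  sequence lets the derivatives be handled by shifting \<open>D\<close>.\<close>

definition taylor_poly :: "(nat \<Rightarrow> real \<Rightarrow> real) \<Rightarrow> nat \<Rightarrow> real \<Rightarrow> real \<Rightarrow> real" where
  "taylor_poly D m x y = (\<Sum>l\<le>m. D l x / fact l * (y - x) ^ l)"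

lemma taylor_poly_has_derivative:
  "((taylor_poly D (Suc m) x) has_field_derivative taylor_poly (\<lambda>l. D (Suc l)) m x y) (at y within S)"
proof -
  have eq: "real (Suc l) * (D (Suc l) x / fact (Suc l) * (y - x) ^ l) = D (Suc l) x / fact l * (y - x) ^ l" for l
    by (simp add: field_simps del: of_nat_Suc)
  have "((\<lambda>y. D 0 x + (\<Sum>l\<le>m. D (Suc l) x / fact (Suc l) * (y - x) ^ Suc l)) has_field_derivative
      (\<Sum>l\<le>m. real (Suc l) * (D (Suc l) x / fact (Suc l) * (y - x) ^ l))) (at y within S)"
    by (auto intro!: derivative_eq_intros sum.cong simp del: of_nat_Suc fact_Suc power_Suc)
  moreover have "taylor_poly D (Suc m) x = (\<lambda>y. D 0 x + (\<Sum>l\<le>m. D (Suc l) x / fact (Suc l) * (y - x) ^ Suc l))"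
    by (auto simp: taylor_poly_def sum.atMost_Suc_shift simp del: sum.atMost_Suc fact_Suc power_Suc)
  ultimately show ?thesis
    by (simp only: eq taylor_poly_def)
qed

text \<open>Induction with the shifted sequence: the remainder has the lower remainder of
  \<open>D (Suc 0)\<close> as derivative, and the mean value inequality on the segment from
  \<open>x\<close> to \<open>y\<close> adds one power.\<close>

lemma taylor_remainder_le:
  assumes "\<And>j y. j < m \<Longrightarrow> y \<in> {0..1} \<Longrightarrow> (D j has_field_derivative D (Suc j) y) (at y within {0..1})"
    and "\<And>y z. y \<in> {0..1} \<Longrightarrow> z \<in> {0..1} \<Longrightarrow> \<bar>D m y - D m z\<bar> \<le> M * \<bar>y - z\<bar>"
    and "x \<in> {0..1}" "y \<in> {0..1::real}"
  shows "\<bar>D 0 y - taylor_poly D m x y\<bar> \<le> M * \<bar>y - x\<bar> ^ Suc m"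
  using assms
proof (induction m arbitrary: D y)
  case 0
  then show ?case by (simp add: taylor_poly_def)
next
  case (Suc m)
  define S where "S = closed_segment x y"
  define \<phi> where "\<phi> = (\<lambda>z. D 0 z - taylor_poly D (Suc m) x z)"
  have S: "S \<subseteq> {0..1}" unfolding S_def
    using Suc.prems(3,4) by (intro closed_segment_subset) auto
  have M: "M \<ge> 0"
    using Suc.prems(2)[of 0 1] by simp
  have "norm (\<phi> y - \<phi> x) \<le> M * \<bar>y - x\<bar> ^ Suc m * norm (y - x)"
  proof (rule field_differentiable_bound[where S = S])
    fix z assume z: "z \<in> S"
    then have z01: "z \<in> {0..1}" using S by auto
    show "(\<phi> has_field_derivative D (Suc 0) z - taylor_poly (\<lambda>l. D (Suc l)) m x z) (at z within S)"
      unfolding \<phi>_def using Suc.prems(1)[of 0 z] z01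
      by (intro DERIV_diff taylor_poly_has_derivative) (auto intro: DERIV_subset[OF _ S])
    have "\<bar>D (Suc 0) z - taylor_poly (\<lambda>l. D (Suc l)) m x z\<bar> \<le> M * \<bar>z - x\<bar> ^ Suc m"
      using Suc.prems z01 by (intro Suc.IH[where D = "\<lambda>l. D (Suc l)"]) auto
    also have "\<dots> \<le> M * \<bar>y - x\<bar> ^ Suc m"
      using z M unfolding S_def
      by (intro mult_left_mono power_mono) (auto simp: closed_segment_eq_real_ivl split: if_splits)
    finally show "norm (D (Suc 0) z - taylor_poly (\<lambda>l. D (Suc l)) m x z) \<le> M * \<bar>y - x\<bar> ^ Suc m"
      by simp
  qed (auto simp: S_def)
  moreover have "\<phi> x = 0"
    by (simp add: \<phi>_def taylor_poly_def sum.atMost_Suc_shift del: sum.atMost_Suc)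
  ultimately show ?case
    by (simp add: \<phi>_def mult_ac)
qed

text \<open>Recentering at \<open>t\<close>: the derivative of order \<open>j\<close> of the Taylor
  polynomial at \<open>x\<close> is the Taylor polynomial at \<open>x\<close> of
  \<open>D j\<close>.\<close>

lemma taylor_poly_reexpand:
  "taylor_poly D m x y = (\<Sum>j\<le>m. taylor_poly (\<lambda>l. D (j + l)) (m - j) x t / fact j * (y - t) ^ j)"
proof -
  have "taylor_poly D m x y = (\<Sum>i\<le>m. \<Sum>j\<le>i. D (j + (i - j)) x / fact (i - j) * (t - x) ^ (i - j) / fact j * (y - t) ^ j)"
    unfolding taylor_poly_def
  proof (rule sum.cong[OF refl])
    fix i
    have "(y - x) ^ i = (\<Sum>j\<le>i. of_nat (i choose j) * (y - t) ^ j * (t - x) ^ (i - j))"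
      using binomial_ring[of "y - t" "t - x" i] by simp
    then show "D i x / fact i * (y - x) ^ i =
        (\<Sum>j\<le>i. D (j + (i - j)) x / fact (i - j) * (t - x) ^ (i - j) / fact j * (y - t) ^ j)"
      by (simp add: sum_distrib_left) (intro sum.cong refl, simp add: binomial_fact field_simps)
  qed
  also have "\<dots> = (\<Sum>(j, l) \<in> {(j, l). j + l \<le> m}. D (j + l) x / fact l * (t - x) ^ l / fact j * (y - t) ^ j)"
    by (rule sum.triangle_reindex_eq[symmetric])
  also have "{(j, l). j + l \<le> m} = Sigma {..m} (\<lambda>j. {..m - j})"
    by auto
  also have "(\<Sum>(j, l) \<in> Sigma {..m} (\<lambda>j. {..m - j}). D (j + l) x / fact l * (t - x) ^ l / fact j * (y - t) ^ j)
     = (\<Sum>j\<le>m. \<Sum>l\<le>m - j. D (j + l) x / fact l * (t - x) ^ l / fact j * (y - t) ^ j)"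
    by (rule sum.Sigma[symmetric]) auto
  finally show ?thesis
    by (simp add: taylor_poly_def sum_distrib_right sum_divide_distrib)
qed

subsection \<open>The quasi-interpolant\<close>

text \<open>
  The \<open>k\<close>-th coefficient is the \<open>k\<close>-th Bernstein coefficient of the Taylor polynomial of \<open>D 0\<close>
  of degree \<open>m\<close> at the node \<open>k / n\<close>.
\<close>

definition quasi_interpolant :: "(nat \<Rightarrow> real \<Rightarrow> real) \<Rightarrow> nat \<Rightarrow> nat \<Rightarrow> nat \<Rightarrow> real" where
  "quasi_interpolant D m n k =
     (\<Sum>j\<le>m. D j (real k / real n) / fact j * Bernstein_coeff n k (local_power n k j))"

text \<open>The Taylor polynomial \<open>q\<close> at \<open>x\<close> is reproduced exactly by its
  own Bernstein coefficients. What remains is the Taylor remainder of each \<open>D j\<close> at the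
  node, of order \<open>m - j + 1\<close> in the distance to \<open>x\<close>; the local
  coefficients supply \<open>n powr (- j / 2)\<close> and the moments the rest.\<close>

lemma quasi_interpolant_error:
  obtains K where "K \<ge> 0"
    "\<And>D M n x. (\<And>j y. j < m \<Longrightarrow> y \<in> {0..1} \<Longrightarrow> (D j has_field_derivative D (Suc j) y) (at y within {0..1})) \<Longrightarrow>
       (\<And>y z. y \<in> {0..1} \<Longrightarrow> z \<in> {0..1} \<Longrightarrow> \<bar>D m y - D m z\<bar> \<le> M * \<bar>y - z\<bar>) \<Longrightarrow>
       n > 0 \<Longrightarrow> 2 * m \<le> n \<Longrightarrow> x \<in> {0..1} \<Longrightarrow>
       \<bar>D 0 x - (\<Sum>k\<le>n. quasi_interpolant D m n k * Bernstein n k x)\<bar>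
         \<le> K * M * (1 / sqrt (real n)) ^ Suc m"
proof -
  obtain K0 where K0: "K0 \<ge> 0" "\<And>n k j. j \<le> m \<Longrightarrow> n > 0 \<Longrightarrow> 2 * m \<le> n \<Longrightarrow> k \<le> n \<Longrightarrow>
     \<bar>Bernstein_coeff n k (local_power n k j)\<bar> \<le> K0 * (1 / sqrt (real n)) ^ j"
    using Bernstein_coeff_local_power_bound by blast
  define K where "K = (\<Sum>j\<le>m. K0 * (6 * fact (Suc (m - j))))"
  show ?thesis
  proof
    show "K \<ge> 0" unfolding K_def using K0(1) by (intro sum_nonneg mult_nonneg_nonneg) simp_all
  next
    fix D :: "nat \<Rightarrow> real \<Rightarrow> real" and M :: real and n :: nat and x :: real
    assume D: "\<And>j y. j < m \<Longrightarrow> y \<in> {0..1} \<Longrightarrow> (D j has_field_derivative D (Suc j) y) (at y within {0..1})"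
      and M: "\<And>y z. y \<in> {0..1} \<Longrightarrow> z \<in> {0..1} \<Longrightarrow> \<bar>D m y - D m z\<bar> \<le> M * \<bar>y - z\<bar>"
      and n: "n > 0" "2 * m \<le> n" and x: "x \<in> {0..1}"
    define r where "r = 1 / sqrt (real n)"
    have r: "r > 0" using n by (simp add: r_def)
    have M0: "M \<ge> 0" using M[of 0 1] by simp
    define T where "T = (\<lambda>j t. taylor_poly (\<lambda>l. D (j + l)) (m - j) x t)"
    define q where "q = (\<Sum>i\<le>m. smult (D i x / fact i) ([:- x, 1:] ^ i))"
    define b where "b = (\<lambda>k j. Bernstein_coeff n k (local_power n k j))"
    \<comment> \<open>The same polynomial written around an arbitrary node \<open>t\<close>, to be
      compared termwise with the quasi-interpolant there.\<close>
    have q_eq: "q = (\<Sum>j\<le>m. smult (T j t / fact j) ([:- t, 1:] ^ j))" for t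
    proof (rule poly_eq_poly_eq_iff[THEN iffD1], rule ext)
      fix y
      show "poly q y = poly (\<Sum>j\<le>m. smult (T j t / fact j) ([:- t, 1:] ^ j)) y"
        using taylor_poly_reexpand[of D m x y t]
        by (simp add: q_def T_def poly_sum poly_power taylor_poly_def)
    qed
    have "degree q \<le> m"
      unfolding q_def
      by (intro degree_sum_le order.trans[OF degree_smult_le] order.trans[OF degree_power_le]) auto
    then have "(\<Sum>k\<le>n. Bernstein_coeff n k q * Bernstein n k x) = poly q x"
      using n by (intro sum_Bernstein_coeff) auto
    also have "poly q x = D 0 x"
      by (simp add: q_def poly_sum poly_power sum.atMost_shift)
    finally have q: "D 0 x = (\<Sum>k\<le>n. Bernstein_coeff n k q * Bernstein n k x)" by simp
    have local: "\<bar>Bernstein_coeff n k q - quasi_interpolant D m n k\<bar> \<le>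
        (\<Sum>j\<le>m. M * \<bar>real k / real n - x\<bar> ^ Suc (m - j) * (K0 * r ^ j))" if k: "k \<le> n" for k
    proof -
      define t where "t = real k / real n"
      have t: "t \<in> {0..1}" using k n by (auto simp: t_def)
      have "Bernstein_coeff n k q = (\<Sum>j\<le>m. T j t / fact j * b k j)"
        unfolding b_def local_power_def t_def[symmetric]
        by (subst q_eq[of t]) (simp only: Bernstein_coeff_sum Bernstein_coeff_smult)
      then have "\<bar>Bernstein_coeff n k q - quasi_interpolant D m n k\<bar> =
          \<bar>\<Sum>j\<le>m. (T j t - D j t) / fact j * b k j\<bar>"
        unfolding quasi_interpolant_def b_def t_def[symmetric]
        by (simp only: sum_subtractf[symmetric] diff_divide_distrib left_diff_distrib)
      also have "\<dots> \<le> (\<Sum>j\<le>m. M * \<bar>t - x\<bar> ^ Suc (m - j) * (K0 * r ^ j))"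
      proof (rule order.trans[OF sum_abs], rule sum_mono)
        fix j assume j: "j \<in> {..m}"
        have "\<bar>D (j + 0) t - T j t\<bar> \<le> M * \<bar>t - x\<bar> ^ Suc (m - j)"
          unfolding T_def using D M x t j
          by (intro taylor_remainder_le[where D = "\<lambda>l. D (j + l)"]) auto
        moreover have "\<bar>(T j t - D j t) / fact j\<bar> \<le> \<bar>D j t - T j t\<bar>"
        proof -
          have "\<bar>T j t - D j t\<bar> / fact j \<le> \<bar>T j t - D j t\<bar> / 1"
            by (intro divide_left_mono fact_ge_1) auto
          then show ?thesis by (simp add: abs_minus_commute)
        qed
        ultimately have "\<bar>(T j t - D j t) / fact j\<bar> \<le> M * \<bar>t - x\<bar> ^ Suc (m - j)" by simp
        then show "\<bar>(T j t - D j t) / fact j * b k j\<bar> \<le> M * \<bar>t - x\<bar> ^ Suc (m - j) * (K0 * r ^ j)"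
          unfolding abs_mult using K0(2)[of j n k] j n k M0
          by (intro mult_mono) (auto simp: b_def r_def)
      qed
      finally show ?thesis by (simp add: t_def)
    qed
    have "D 0 x - (\<Sum>k\<le>n. quasi_interpolant D m n k * Bernstein n k x) =
        (\<Sum>k\<le>n. (Bernstein_coeff n k q - quasi_interpolant D m n k) * Bernstein n k x)"
      unfolding q by (simp add: sum_subtractf left_diff_distrib)
    also have "\<bar>\<dots>\<bar> \<le> (\<Sum>k\<le>n. (\<Sum>j\<le>m. M * \<bar>real k / real n - x\<bar> ^ Suc (m - j) * (K0 * r ^ j)) * Bernstein n k x)"
    proof (rule order.trans[OF sum_abs], rule sum_mono)
      fix k assume "k \<in> {..n}"
      then show "\<bar>(Bernstein_coeff n k q - quasi_interpolant D m n k) * Bernstein n k x\<bar> \<le>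
          (\<Sum>j\<le>m. M * \<bar>real k / real n - x\<bar> ^ Suc (m - j) * (K0 * r ^ j)) * Bernstein n k x"
        using local[of k] Bernstein_nonneg[of x n k] x
        by (simp add: abs_mult mult_right_mono)
    qed
    also have "\<dots> = (\<Sum>j\<le>m. M * (K0 * r ^ j) * (\<Sum>k\<le>n. \<bar>real k / real n - x\<bar> ^ Suc (m - j) * Bernstein n k x))"
      unfolding sum_distrib_right sum_distrib_left by (subst sum.swap) (intro sum.cong refl, simp only: mult_ac)
    also have "\<dots> \<le> (\<Sum>j\<le>m. M * (K0 * r ^ j) * (6 * fact (Suc (m - j)) * r ^ Suc (m - j)))"
      unfolding r_def using M0 K0(1) n x
      by (intro sum_mono mult_left_mono Bernstein_abs_moment_le) auto
    also have "\<dots> = (\<Sum>j\<le>m. K0 * (6 * fact (Suc (m - j))) * (M * r ^ Suc m))"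
    proof (rule sum.cong[OF refl])
      fix j assume "j \<in> {..m}"
      then have "r ^ Suc m = r ^ j * r ^ Suc (m - j)" by (simp flip: power_add power_Suc)
      then show "M * (K0 * r ^ j) * (6 * fact (Suc (m - j)) * r ^ Suc (m - j)) =
          K0 * (6 * fact (Suc (m - j))) * (M * r ^ Suc m)"
        by (simp only: mult_ac)
    qed
    also have "\<dots> = K * M * r ^ Suc m"
      by (simp only: K_def sum_distrib_right mult.assoc)
    finally show "\<bar>D 0 x - (\<Sum>k\<le>n. quasi_interpolant D m n k * Bernstein n k x)\<bar>
        \<le> K * M * (1 / sqrt (real n)) ^ Suc m" by (simp only: r_def)
  qed
qed

subsection \<open>An interpolation inequality for derivatives\<close>

text \<open>Values at distinct nodes control the coefficients. Synthetic division at the new node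
  \<open>a\<close> lowers the degree by one, and the quotient is bounded on the remaining
  nodes.\<close>

lemma l1_norm_le_nodes:
  fixes A :: "real set"
  assumes "finite A"
  shows "\<exists>K\<ge>0. \<forall>q B. degree q < card A \<and> (\<forall>y\<in>A. \<bar>poly q y\<bar> \<le> B) \<longrightarrow> l1_norm q \<le> K * B"
  using assms
proof (induction A rule: finite_induct)
  case empty
  then show ?case by auto
next
  case (insert a A)
  obtain K where K: "K \<ge> 0" "\<And>q B. degree q < card A \<Longrightarrow> (\<And>y. y \<in> A \<Longrightarrow> \<bar>poly q y\<bar> \<le> B) \<Longrightarrow> l1_norm q \<le> K * B"
    using insert.IH by blast
  define W where "W = (\<Sum>y\<in>A. 1 / \<bar>y - a\<bar>)"
  have W: "W \<ge> 0" by (simp add: W_def sum_nonneg)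
  define K' where "K' = 1 + (\<bar>a\<bar> + 1) * (K * (2 * W))"
  have "l1_norm q \<le> K' * B"
    if q: "degree q < card (insert a A)" and B: "\<And>y. y \<in> insert a A \<Longrightarrow> \<bar>poly q y\<bar> \<le> B" for q B
  proof -
    define p where "p = synthetic_div q a"
    have q_eq: "q = [:poly q a:] + [:- a, 1:] * p"
      using synthetic_div_correct'[of a q] by (simp add: p_def add.commute)
    have B0: "B \<ge> 0" using B[of a] by force
    have p_le: "\<bar>poly p y\<bar> \<le> 2 * W * B" if y: "y \<in> A" for y
    proof -
      have ne: "\<bar>y - a\<bar> > 0" using y insert.hyps by auto
      have "poly q y = poly q a + (y - a) * poly p y"
        by (subst q_eq) (simp add: left_diff_distrib)
      then have "\<bar>y - a\<bar> * \<bar>poly p y\<bar> = \<bar>poly q y - poly q a\<bar>"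
        by (simp add: abs_mult)
      also have "\<dots> \<le> 2 * B" using B[of y] B[of a] y by auto
      finally have "\<bar>poly p y\<bar> \<le> 1 / \<bar>y - a\<bar> * (2 * B)"
        using ne by (simp add: field_simps)
      also have "\<dots> \<le> W * (2 * B)"
        unfolding W_def using y insert.hyps B0 by (intro mult_right_mono member_le_sum) auto
      finally show ?thesis by simp
    qed
    have "l1_norm p \<le> K * (2 * W * B)"
    \<comment> \<open>A constant \<open>q\<close> is treated apart: \<open>A\<close> may then be
      empty, and no degree is below 0.\<close>
    proof (cases "degree q = 0")
      case True
      then have "p = 0" by (simp add: p_def synthetic_div_eq_0_iff)
      then show ?thesis using K W B0 by simp
    next
      case False
      then have "degree p < card A"
        using q insert.hyps by (simp add: p_def degree_synthetic_div)
      then show ?thesis using p_le by (intro K(2)) auto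
    qed
    have "l1_norm q \<le> l1_norm [:poly q a:] + l1_norm ([:- a, 1:] * p)"
      by (subst q_eq) (rule l1_norm_add_le)
    also have "\<dots> \<le> B + l1_norm [:- a, 1:] * l1_norm p"
      using B[of a] by (intro add_mono l1_norm_mult_le) auto
    also have "\<dots> \<le> B + (\<bar>a\<bar> + 1) * (K * (2 * W * B))"
      using \<open>l1_norm p \<le> K * (2 * W * B)\<close> by (intro add_left_mono mult_mono) auto
    also have "\<dots> = K' * B" by (simp add: K'_def algebra_simps)
    finally show ?thesis .
  qed
  moreover have "K' \<ge> 0" using K W by (simp add: K'_def)
  ultimately show ?case by blast
qed

text \<open>A Landau-Kolmogorov type inequality. The Taylor polynomial at \<open>a\<close>, rescaled
  by a step of length \<open>H\<close>, is at most \<open>1 + M * H ^ Suc m\<close> on the unit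
  interval, hence so are its coefficients up to a constant.\<close>

lemma derivative_interpolation:
  obtains K where "K \<ge> 0"
    "\<And>(D :: nat \<Rightarrow> real \<Rightarrow> real) M H a j. (\<And>j y. j < m \<Longrightarrow> y \<in> {0..1} \<Longrightarrow> (D j has_field_derivative D (Suc j) y) (at y within {0..1})) \<Longrightarrow>
       (\<And>y z. y \<in> {0..1} \<Longrightarrow> z \<in> {0..1} \<Longrightarrow> \<bar>D m y - D m z\<bar> \<le> M * \<bar>y - z\<bar>) \<Longrightarrow>
       (\<And>y. y \<in> {0..1} \<Longrightarrow> \<bar>D 0 y\<bar> \<le> 1) \<Longrightarrow>
       0 \<le> H \<Longrightarrow> H \<le> 1 / 2 \<Longrightarrow> a \<in> {0..1} \<Longrightarrow> j \<le> m \<Longrightarrow>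
       \<bar>D j a\<bar> / fact j * H ^ j \<le> K * (1 + M * H ^ Suc m)"
proof -
  \<comment> \<open>Some \<open>m + 1\<close> distinct nodes in the unit interval, fixed once so
    that \<open>K\<close> depends on \<open>m\<close> alone.\<close>
  define A where "A = (\<lambda>i::nat. 1 / real (Suc i)) ` {..m}"
  have "inj_on (\<lambda>i::nat. 1 / real (Suc i)) {..m}"
    by (auto simp: inj_on_def)
  then have card_A: "card A = Suc m" "finite A"
    by (auto simp: A_def card_image)
  obtain K where K: "K \<ge> 0" "\<And>q B. degree q < card A \<Longrightarrow> (\<And>y. y \<in> A \<Longrightarrow> \<bar>poly q y\<bar> \<le> B) \<Longrightarrow> l1_norm q \<le> K * B"
    using l1_norm_le_nodes[OF card_A(2)] by blast
  show ?thesis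
  proof
    show "K \<ge> 0" by (rule K(1))
  next
    fix D :: "nat \<Rightarrow> real \<Rightarrow> real" and M H a :: real and j :: nat
    assume D: "\<And>j y. j < m \<Longrightarrow> y \<in> {0..1} \<Longrightarrow> (D j has_field_derivative D (Suc j) y) (at y within {0..1})"
      and M: "\<And>y z. y \<in> {0..1} \<Longrightarrow> z \<in> {0..1} \<Longrightarrow> \<bar>D m y - D m z\<bar> \<le> M * \<bar>y - z\<bar>"
      and D0: "\<And>y. y \<in> {0..1} \<Longrightarrow> \<bar>D 0 y\<bar> \<le> 1"
      and H: "0 \<le> H" "H \<le> 1 / 2" and a: "a \<in> {0..1}" and j: "j \<le> m"
    have M0: "M \<ge> 0" using M[of 0 1] by simp
    \<comment> \<open>The step points towards the farther endpoint; with
      \<open>H \<le> 1 / 2\<close> the points \<open>a + h * y\<close> stay in the interval.\<close>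
    define h where "h = (if a \<le> 1 / 2 then H else - H)"
    have h: "\<bar>h\<bar> = H" using H by (simp add: h_def)
    define q where "q = (\<Sum>i\<le>m. monom (D i a / fact i * h ^ i) i)"
    have deg: "degree q \<le> m"
      unfolding q_def by (intro degree_sum_le order.trans[OF degree_monom_le]) auto
    have "l1_norm q \<le> K * (1 + M * H ^ Suc m)"
    proof (rule K(2))
      show "degree q < card A" using deg card_A by simp
    next
      fix y assume "y \<in> A"
      then have y: "0 \<le> y" "y \<le> 1" by (auto simp: A_def)
      have "H * y \<le> 1 / 2" "0 \<le> H * y" using H y mult_mono[of H "1/2" y 1] by auto
      then have z: "a + h * y \<in> {0..1}" using a by (auto simp: h_def)
      have "poly q y = taylor_poly D m a (a + h * y)"
        by (simp add: q_def taylor_poly_def poly_sum poly_monom power_mult_distrib mult.assoc)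
      then have "\<bar>D 0 (a + h * y) - poly q y\<bar> \<le> M * \<bar>h * y\<bar> ^ Suc m"
        using taylor_remainder_le[OF D M a z] by simp
      also have "\<dots> \<le> M * H ^ Suc m"
        using y h H M0 by (intro mult_left_mono power_mono) (auto simp: abs_mult mult_left_le)
      finally show "\<bar>poly q y\<bar> \<le> 1 + M * H ^ Suc m"
        using D0[OF z] by linarith
    qed
    moreover have "coeff q j = D j a / fact j * h ^ j"
      using j by (simp add: q_def coeff_sum)
    then have "\<bar>coeff q j\<bar> = \<bar>D j a\<bar> / fact j * H ^ j"
      by (simp add: abs_mult power_abs h)
    ultimately show "\<bar>D j a\<bar> / fact j * H ^ j \<le> K * (1 + M * H ^ Suc m)"
      using abs_coeff_le_l1_norm[of q j] by simp
  qed
qed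

subsection \<open>Functions on the unit interval\<close>

lemma deriv01_has_field_derivative:
  assumes "f \<in> C01 m" "j < m" "x \<in> {0..1}"
  shows "(deriv01 j f has_field_derivative deriv01 (Suc j) f x) (at x within {0..1})"
proof -
  have "deriv01 j f differentiable (at x within {0..1})"
    using assms by (auto simp: C01_def differentiable_on_def)
  then have "(deriv01 j f has_vector_derivative vector_derivative (deriv01 j f) (at x within {0..1})) (at x within {0..1})"
    by (simp add: vector_derivative_works)
  then show ?thesis
    by (simp add: has_real_derivative_iff_has_vector_derivative deriv01_def)
qed

text \<open>Continuity on the compact interval provides the boundedness without which the real
  \<open>SUP\<close> carries no information.\<close>

lemma abs_le_sup_norm01:
  assumes "f \<in> C01 m" "m > 0" "x \<in> {0..1}"
  shows "\<bar>f x\<bar> \<le> sup_norm01 f"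
proof -
  have "f differentiable_on {0..1}"
    using assms by (force simp: C01_def deriv01_def)
  then have "continuous_on {0..1} (\<lambda>x. \<bar>f x\<bar>)"
    by (intro continuous_on_rabs differentiable_imp_continuous_on)
  then have "bdd_above ((\<lambda>x. \<bar>f x\<bar>) ` {0..1})"
    by (intro bounded_imp_bdd_above compact_imp_bounded compact_continuous_image compact_Icc)
  then show ?thesis
    unfolding sup_norm01_def using assms(3) by (rule cSUP_upper2) simp
qed

text \<open>Each difference quotient is a lower bound for all Lipschitz constants, hence for their
  infimum.\<close>

lemma Lip01_abs_diff_le:
  assumes "g \<in> Lip01" "x \<in> {0..1}" "y \<in> {0..1}"
  shows "\<bar>g x - g y\<bar> \<le> lip_seminorm01 g * \<bar>x - y\<bar>"
proof (cases "x = y")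
  case False
  have "\<bar>g x - g y\<bar> / \<bar>x - y\<bar> \<le> lip_seminorm01 g"
    unfolding lip_seminorm01_def
  proof (rule cInf_greatest)
    show "{L. L-lipschitz_on {0..1} g} \<noteq> {}" using assms(1) by (auto simp: Lip01_def)
  next
    fix L assume "L \<in> {L. L-lipschitz_on {0..1} g}"
    then have "\<bar>g x - g y\<bar> \<le> L * \<bar>x - y\<bar>"
      using lipschitz_onD[of L "{0..1}" g x y] assms by (simp add: dist_real_def)
    then show "\<bar>g x - g y\<bar> / \<bar>x - y\<bar> \<le> L" using False by (simp add: divide_le_eq)
  qed
  then show ?thesis using False by (simp add: divide_le_eq)
qed simp

text \<open>Follows from \<open>X \<le> 1\<close>. It allows the endpoint term to pay for small
  \<open>n\<close>.\<close>

lemma endpoint_term_ge: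
  assumes "x \<in> {0..1}" "n > 0"
  shows "(1 / sqrt (real n)) ^ s \<le> endpoint_term s n (x * (1 - x))"
proof -
  define X where "X = x * (1 - x)"
  have X: "0 \<le> X" "X \<le> 1" using assms by (auto simp: X_def mult_le_one)
  have le1: "(1 / sqrt (real n)) ^ s \<le> 1"
    using assms(2) by (intro power_le_one) auto
  have eq: "real n powr (- real s / 2) = (1 / sqrt (real n)) ^ s"
    using assms(2) by (intro powr_minus_half_of_nat) simp
  have "(1 / sqrt (real n)) ^ s \<le> X powr (- real s) * (1 / sqrt (real n)) ^ s" if "X \<noteq> 0"
  proof -
    have "X powr 0 \<le> X powr (- real s)"
      using X that by (intro powr_mono') auto
    then have "1 \<le> X powr (- real s)" using that by simp
    then show ?thesis using mult_right_mono[of 1 "X powr (- real s)" "(1 / sqrt (real n)) ^ s"] by simp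
  qed
  then show ?thesis
    unfolding X_def[symmetric] endpoint_term_def eq using le1 by auto
qed

section \<open>Choice of the constants and the two regimes of \<open>n\<close> and the Lipschitz
  constant\<close>

theorem theorem7:
  shows "\<exists>c::real. c > 0 \<and>
    (\<forall>s::nat. s \<ge> 3 \<longrightarrow> (\<forall>\<mu>::real. \<mu> < 1 \<longrightarrow>
      (\<exists>C::real. C > 0 \<and>
        (\<forall>f::real \<Rightarrow> real.
          f \<in> C01 (s - 1) \<and> deriv01 (s - 1) f \<in> Lip01 \<and> sup_norm01 f \<le> \<mu> \<longrightarrow>
          (\<forall>n::nat. n > 0 \<and> real n \<ge> c * sup_norm01 (deriv01 2 f) / (1 - \<mu>) \<longrightarrow>
            (\<exists>\<sigma>::nat \<Rightarrow> real. (\<forall>k\<le>n. \<sigma> k \<in> {-1, 1}) \<and>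
              (\<forall>x\<in>{0..1}.
                \<bar>f x - (\<Sum>k\<le>n. \<sigma> k * Bernstein n k x)\<bar>
                  \<le> C * (CLip_norm01 (s - 1) f * real n powr (- real s / 2)
                         + endpoint_term s n (x * (1 - x))))))))))"
proof -
  have main: "\<exists>C::real. C > 0 \<and> (\<forall>f n. f \<in> C01 (s - 1) \<and> deriv01 (s - 1) f \<in> Lip01 \<and> sup_norm01 f \<le> \<mu> \<and> n > 0 \<longrightarrow>
            (\<exists>\<sigma>::nat \<Rightarrow> real. (\<forall>k\<le>n. \<sigma> k \<in> {-1, 1}) \<and>
              (\<forall>x\<in>{0..1}. \<bar>f x - (\<Sum>k\<le>n. \<sigma> k * Bernstein n k x)\<bar>
                  \<le> C * (CLip_norm01 (s - 1) f * real n powr (- real s / 2)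
                         + endpoint_term s n (x * (1 - x))))))"
    if s: "s \<ge> 3" and \<mu>: "\<mu> < 1" for s :: nat and \<mu> :: real
  proof -
    define m where "m = s - 1"
    have m: "Suc m = s" "m > 0" using s by (auto simp: m_def)
    \<comment> \<open>Halfway between \<open>\<mu>\<close> and 1: the coefficients may exceed the
      bound on \<open>f\<close> by \<open>(1 - \<mu>) / 2\<close>.\<close>
    define \<nu> where "\<nu> = (1 + \<mu>) / 2"
    have \<nu>: "\<nu> < 1" using \<mu> by (simp add: \<nu>_def)
    obtain K1 where K1: "K1 \<ge> 0"
      "\<And>D M n x. (\<And>j y. j < m \<Longrightarrow> y \<in> {0..1} \<Longrightarrow> (D j has_field_derivative D (Suc j) y) (at y within {0..1})) \<Longrightarrow>
         (\<And>y z. y \<in> {0..1} \<Longrightarrow> z \<in> {0..1} \<Longrightarrow> \<bar>D m y - D m z\<bar> \<le> M * \<bar>y - z\<bar>) \<Longrightarrow>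
         n > 0 \<Longrightarrow> 2 * m \<le> n \<Longrightarrow> x \<in> {0..1} \<Longrightarrow>
         \<bar>D 0 x - (\<Sum>k\<le>n. quasi_interpolant D m n k * Bernstein n k x)\<bar>
           \<le> K1 * M * (1 / sqrt (real n)) ^ Suc m"
      by (rule quasi_interpolant_error[of m]) blast
    obtain K2 where K2: "K2 \<ge> 0" "\<And>n k j. j \<le> m \<Longrightarrow> n > 0 \<Longrightarrow> 2 * m \<le> n \<Longrightarrow> k \<le> n \<Longrightarrow>
       \<bar>Bernstein_coeff n k (local_power n k j)\<bar> \<le> K2 * (1 / sqrt (real n)) ^ j"
      by (rule Bernstein_coeff_local_power_bound[of m]) blast
    obtain K3 where K3: "K3 \<ge> 0"
      "\<And>(D :: nat \<Rightarrow> real \<Rightarrow> real) M H a j. (\<And>j y. j < m \<Longrightarrow> y \<in> {0..1} \<Longrightarrow> (D j has_field_derivative D (Suc j) y) (at y within {0..1})) \<Longrightarrow>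
         (\<And>y z. y \<in> {0..1} \<Longrightarrow> z \<in> {0..1} \<Longrightarrow> \<bar>D m y - D m z\<bar> \<le> M * \<bar>y - z\<bar>) \<Longrightarrow>
         (\<And>y. y \<in> {0..1} \<Longrightarrow> \<bar>D 0 y\<bar> \<le> 1) \<Longrightarrow>
         0 \<le> H \<Longrightarrow> H \<le> 1 / 2 \<Longrightarrow> a \<in> {0..1} \<Longrightarrow> j \<le> m \<Longrightarrow>
         \<bar>D j a\<bar> / fact j * H ^ j \<le> K3 * (1 + M * H ^ Suc m)"
      by (rule derivative_interpolation[of m]) blast
    have "s > 0" using s by simp
    then obtain K4 where K4: "K4 > 0"
      "\<And>n a. n > 0 \<Longrightarrow> (\<And>k. k \<le> n \<Longrightarrow> \<bar>a k\<bar> \<le> \<nu>) \<Longrightarrow>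
         \<exists>\<sigma>::nat \<Rightarrow> real. (\<forall>k\<le>n. \<sigma> k \<in> {-1, 1}) \<and>
           (\<forall>x\<in>{0..1}. \<bar>(\<Sum>k\<le>n. a k * Bernstein n k x) - (\<Sum>k\<le>n. \<sigma> k * Bernstein n k x)\<bar>
              \<le> K4 * endpoint_term s n (x * (1 - x)))"
      by (rule sigma_delta_Bernstein[OF _ \<nu>]) blast
    \<comment> \<open>Chosen so that the \<open>m\<close> terms of positive order in a coefficient,
      each at most \<open>2 * K3 / L * K2\<close>, use up no more than that slack.\<close>
    define L where "L = 1 + real m * (4 * K3 * K2) / (1 - \<mu>)"
    have L: "L \<ge> 1" "real m * (2 * K3 / L * K2) \<le> (1 - \<mu>) / 2"
    proof -
      have "real m * (4 * K3 * K2) / (1 - \<mu>) \<ge> 0" using K2(1) K3(1) \<mu> by simp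
      then show L1: "L \<ge> 1" by (simp add: L_def)
      have "real m * (4 * K3 * K2) = (L - 1) * (1 - \<mu>)" using \<mu> by (simp add: L_def)
      also have "\<dots> \<le> L * (1 - \<mu>)" using \<mu> by (intro mult_right_mono) auto
      finally show "real m * (2 * K3 / L * K2) \<le> (1 - \<mu>) / 2" using L1 by (simp add: field_simps)
    qed
    \<comment> \<open>For \<open>n \<ge> N\<close> the step \<open>L / sqrt n\<close> is at most
      \<open>1 / 2\<close>, as the interpolation inequality asks, and
      \<open>2 * m \<le> n\<close>.\<close>
    define N where "N = 4 * L ^ 2 + 2 * real m"
    have N: "N > 0" using L(1) by (auto simp: N_def intro!: add_pos_nonneg)
    \<comment> \<open>The first two summands serve the quantization; the last two push the
      right-hand side to 2 when \<open>n < N\<close> or when the Lipschitz constant is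
      large.\<close>
    define C where "C = K1 + K4 + 2 * sqrt N ^ s + 2 * L ^ s"
    have nonneg: "0 \<le> sqrt N ^ s" "0 \<le> L ^ s" using N L(1) by simp_all
    have C_pos: "C > 0" unfolding C_def using K1(1) K4(1) nonneg by linarith
    have C_ge: "K1 \<le> C" "K4 \<le> C" "2 * sqrt N ^ s \<le> C" "2 * L ^ s \<le> C"
      unfolding C_def using K1(1) K4(1) nonneg by linarith+
    have "\<exists>\<sigma>::nat \<Rightarrow> real. (\<forall>k\<le>n. \<sigma> k \<in> {-1, 1}) \<and>
              (\<forall>x\<in>{0..1}. \<bar>f x - (\<Sum>k\<le>n. \<sigma> k * Bernstein n k x)\<bar>
                  \<le> C * (CLip_norm01 (s - 1) f * real n powr (- real s / 2)
                         + endpoint_term s n (x * (1 - x))))"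
      if f: "f \<in> C01 m" "deriv01 m f \<in> Lip01" "sup_norm01 f \<le> \<mu>" and n: "n > 0" for f and n :: nat
    proof -
      define D where "D = (\<lambda>j. deriv01 j f)"
      define M where "M = lip_seminorm01 (deriv01 m f)"
      define r where "r = 1 / sqrt (real n)"
      have r: "r > 0" using n by (simp add: r_def)
      have rs: "real n powr (- real s / 2) = r ^ s"
        unfolding r_def using n by (intro powr_minus_half_of_nat) simp
      have D: "\<And>j y. j < m \<Longrightarrow> y \<in> {0..1} \<Longrightarrow> (D j has_field_derivative D (Suc j) y) (at y within {0..1})"
        unfolding D_def by (rule deriv01_has_field_derivative[OF f(1)])
      have M: "\<And>y z. y \<in> {0..1} \<Longrightarrow> z \<in> {0..1} \<Longrightarrow> \<bar>D m y - D m z\<bar> \<le> M * \<bar>y - z\<bar>"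
        unfolding D_def M_def by (rule Lip01_abs_diff_le[OF f(2)])
      have D0: "D 0 = f" by (simp add: D_def deriv01_def)
      have f_le: "\<bar>f y\<bar> \<le> \<mu>" if "y \<in> {0..1}" for y
        using abs_le_sup_norm01[OF f(1) m(2) that] f(3) by linarith
      have D0_le: "\<And>y. y \<in> {0..1} \<Longrightarrow> \<bar>D 0 y\<bar> \<le> 1"
        using f_le \<mu> unfolding D0 by (meson less_imp_le order.trans)
      have M0: "M \<ge> 0" using M[of 0 1] by simp
      have M_le: "M * r ^ s \<le> CLip_norm01 (s - 1) f * real n powr (- real s / 2)"
        unfolding rs using r by (intro mult_right_mono) (auto simp: CLip_norm01_def M_def m_def)
      have ep: "r ^ s \<le> endpoint_term s n (x * (1 - x))" if "x \<in> {0..1}" for x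
        unfolding r_def using endpoint_term_ge[OF that n] .
      have split: "K1 * (M * r ^ s) + K4 * e \<le> C * (CLip_norm01 (s - 1) f * real n powr (- real s / 2) + e)"
        if "e \<ge> 0" for e
      proof -
        have "K1 * (M * r ^ s) \<le> C * (M * r ^ s)" "K4 * e \<le> C * e"
          using C_ge M0 r that by (auto intro!: mult_right_mono)
        moreover have "C * (M * r ^ s) \<le> C * (CLip_norm01 (s - 1) f * real n powr (- real s / 2))"
          using M_le C_pos by (intro mult_left_mono) auto
        ultimately show ?thesis by (simp add: distrib_left)
      qed
      show ?thesis
      proof (cases "N \<le> real n \<and> M * (L * r) ^ s \<le> 1")
        case True
        have n2: "2 * m \<le> n"
        proof -
          have "real (2 * m) \<le> N" by (simp add: N_def)
          then show ?thesis using True by linarith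
        qed
        have H: "0 \<le> L * r" "L * r \<le> 1 / 2"
        proof -
          show "0 \<le> L * r" using L r by simp
          have "(2 * L) ^ 2 \<le> real n" using True by (simp add: N_def power_mult_distrib)
          then have "2 * L \<le> sqrt (real n)" using L(1) by (intro real_le_rsqrt)
          then show "L * r \<le> 1 / 2" using n by (simp add: r_def field_simps)
        qed
        define a where "a = quasi_interpolant D m n"
        have a: "\<bar>a k\<bar> \<le> \<nu>" if k: "k \<le> n" for k
        proof -
          define t where "t = real k / real n"
          have t: "t \<in> {0..1}" using k n by (auto simp: t_def)
          have summand: "\<bar>D j t / fact j * Bernstein_coeff n k (local_power n k j)\<bar> \<le> 2 * K3 / L * K2"
            if j: "j \<in> {1..m}" for j
          proof -
            have "\<bar>D j t\<bar> / fact j * (L * r) ^ j \<le> K3 * (1 + M * (L * r) ^ Suc m)"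
              using K3(2)[where D = D and M = M and a = t and j = j, OF D M D0_le H t] j by simp
            also have "\<dots> \<le> K3 * 2"
              using True K3(1) m(1) by (intro mult_left_mono) auto
            finally have *: "\<bar>D j t\<bar> / fact j * (L * r) ^ j \<le> K3 * 2" .
            \<comment> \<open>Since \<open>j \<ge> 1\<close>, the interpolation inequality with step
              \<open>L * r\<close> gains at least one factor \<open>1 / L\<close> over the step
              \<open>r\<close>.\<close>
            have "\<bar>D j t\<bar> / fact j * r ^ j * L \<le> \<bar>D j t\<bar> / fact j * r ^ j * L ^ j"
              using L(1) r j by (intro mult_left_mono self_le_power) auto
            also have "\<dots> = \<bar>D j t\<bar> / fact j * (L * r) ^ j"
              by (simp only: power_mult_distrib mult_ac)
            finally have **: "\<bar>D j t\<bar> / fact j * r ^ j \<le> 2 * K3 / L"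
              using * L(1) by (simp only: pos_le_divide_eq mult.commute[of 2 K3])
            have "\<bar>D j t / fact j * Bernstein_coeff n k (local_power n k j)\<bar>
                \<le> \<bar>D j t\<bar> / fact j * (K2 * r ^ j)"
              unfolding abs_mult r_def using K2(2)[of j n k] j n n2 k
              by (intro mult_mono) (auto simp: abs_divide)
            also have "\<dots> = (\<bar>D j t\<bar> / fact j * r ^ j) * K2" by (simp only: mult_ac)
            also have "\<dots> \<le> 2 * K3 / L * K2" using ** K2(1) by (rule mult_right_mono)
            finally show ?thesis .
          qed
          have "{..m} = insert 0 {1..m}" by auto
          then have "a k = f t + (\<Sum>j\<in>{1..m}. D j t / fact j * Bernstein_coeff n k (local_power n k j))"
            by (simp add: a_def quasi_interpolant_def t_def[symmetric] D0 local_power_def)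
          also have "\<bar>\<dots>\<bar> \<le> \<bar>f t\<bar> + (\<Sum>j\<in>{1..m}. \<bar>D j t / fact j * Bernstein_coeff n k (local_power n k j)\<bar>)"
            by (intro order.trans[OF abs_triangle_ineq] add_left_mono sum_abs)
          also have "\<dots> \<le> \<mu> + (\<Sum>j\<in>{1..m}. 2 * K3 / L * K2)"
            by (intro add_mono sum_mono summand f_le t)
          also have "\<dots> \<le> \<mu> + (1 - \<mu>) / 2"
            using L(2) by simp
          also have "\<dots> = \<nu>" by (simp add: \<nu>_def field_simps)
          finally show ?thesis .
        qed
        obtain \<sigma> :: "nat \<Rightarrow> real" where \<sigma>: "\<forall>k\<le>n. \<sigma> k \<in> {-1, 1}"
          "\<And>x. x \<in> {0..1} \<Longrightarrow> \<bar>(\<Sum>k\<le>n. a k * Bernstein n k x) - (\<Sum>k\<le>n. \<sigma> k * Bernstein n k x)\<bar>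
              \<le> K4 * endpoint_term s n (x * (1 - x))"
          using K4(2)[of n a] n a by blast
        have "\<bar>f x - (\<Sum>k\<le>n. \<sigma> k * Bernstein n k x)\<bar>
            \<le> C * (CLip_norm01 (s - 1) f * real n powr (- real s / 2) + endpoint_term s n (x * (1 - x)))"
          if x: "x \<in> {0..1}" for x
        proof -
          have "\<bar>f x - (\<Sum>k\<le>n. a k * Bernstein n k x)\<bar> \<le> K1 * (M * r ^ s)"
            using K1(2)[where D = D and M = M, OF D M n n2 x] by (simp add: D0 a_def r_def m(1) mult.assoc)
          with \<sigma>(2)[OF x] have "\<bar>f x - (\<Sum>k\<le>n. \<sigma> k * Bernstein n k x)\<bar>
              \<le> K1 * (M * r ^ s) + K4 * endpoint_term s n (x * (1 - x))"
            by linarith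
          also have "\<dots> \<le> C * (CLip_norm01 (s - 1) f * real n powr (- real s / 2) + endpoint_term s n (x * (1 - x)))"
            using ep[OF x] r by (intro split) (auto intro: order.trans[of 0 "r ^ s"])
          finally show ?thesis .
        qed
        with \<sigma>(1) show ?thesis by blast
      next
        case False
        have "2 \<le> C * (CLip_norm01 (s - 1) f * real n powr (- real s / 2) + endpoint_term s n (x * (1 - x)))"
          if x: "x \<in> {0..1}" for x
        proof -
          \<comment> \<open>One of the two summands alone is at least 1, according to which
            condition fails.\<close>
          have "1 \<le> L ^ s * (M * r ^ s) + sqrt N ^ s * r ^ s"
          proof (cases "N \<le> real n")
            case True
            then have "1 < M * (L * r) ^ s" using False by auto
            also have "\<dots> = L ^ s * (M * r ^ s)" by (simp only: power_mult_distrib mult_ac)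
            finally show ?thesis using nonneg(1) r by (simp add: add_increasing2)
          next
            case False
            then have "1 \<le> sqrt N * r" using n by (simp add: r_def field_simps)
            then have "1 \<le> (sqrt N * r) ^ s" by (rule one_le_power)
            then show ?thesis using nonneg(2) M0 r by (simp add: power_mult_distrib add_increasing)
          qed
          then have "2 \<le> 2 * L ^ s * (M * r ^ s) + 2 * sqrt N ^ s * r ^ s" by simp
          also have "\<dots> \<le> C * (M * r ^ s) + C * r ^ s"
            using C_ge M0 r by (intro add_mono mult_right_mono) auto
          also have "\<dots> \<le> C * (CLip_norm01 (s - 1) f * real n powr (- real s / 2)) + C * endpoint_term s n (x * (1 - x))"
            using C_pos M_le ep[OF x] by (intro add_mono mult_left_mono) auto
          finally show ?thesis by (simp add: distrib_left)
        qed
        \<comment> \<open>With all signs equal to 1 the sum is the constant 1, and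
          \<open>\<bar>f x\<bar> \<le> \<mu> < 1\<close>.\<close>
        moreover have "\<bar>f x - (\<Sum>k\<le>n. 1 * Bernstein n k x)\<bar> \<le> 2" if "x \<in> {0..1}" for x
          using f_le[OF that] \<mu> by simp
        ultimately have "\<forall>x\<in>{0..1}. \<bar>f x - (\<Sum>k\<le>n. 1 * Bernstein n k x)\<bar>
            \<le> C * (CLip_norm01 (s - 1) f * real n powr (- real s / 2) + endpoint_term s n (x * (1 - x)))"
          by (meson order.trans)
        then show ?thesis
          by (intro exI[of _ "\<lambda>_. 1"]) simp
      qed
    qed
    then show ?thesis
      using C_pos unfolding m_def by blast
  qed
  show ?thesis
  proof (rule exI[of _ 1], intro conjI allI impI)
    fix s :: nat and \<mu> :: real
    assume "s \<ge> 3" "\<mu> < 1"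
    from main[OF this] show "\<exists>C::real. C > 0 \<and>
        (\<forall>f::real \<Rightarrow> real.
          f \<in> C01 (s - 1) \<and> deriv01 (s - 1) f \<in> Lip01 \<and> sup_norm01 f \<le> \<mu> \<longrightarrow>
          (\<forall>n::nat. n > 0 \<and> real n \<ge> 1 * sup_norm01 (deriv01 2 f) / (1 - \<mu>) \<longrightarrow>
            (\<exists>\<sigma>::nat \<Rightarrow> real. (\<forall>k\<le>n. \<sigma> k \<in> {-1, 1}) \<and>
              (\<forall>x\<in>{0..1}.
                \<bar>f x - (\<Sum>k\<le>n. \<sigma> k * Bernstein n k x)\<bar>
                  \<le> C * (CLip_norm01 (s - 1) f * real n powr (- real s / 2)
                         + endpoint_term s n (x * (1 - x)))))))"
      by blast
  qed simp
qed

end
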